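(* Let $X$ be a finite set with $|X|=n$, and let $a\in\mathcal T_X$ be an idempotent with $r=\operatorname{rank}(a)$, where $1<r<n$. Let $A_1,\dots,A_r$ be the $\ker(a)$-classes, $\lambda_i=|A_i|$, and $P=\operatorname{Reg}(\mathcal T_X^a)$. Let $f\in P$ have rank $m$, with $\operatorname{im}(f)=\{f_1,\dots,f_m\}$, where $f_i\in A_{k_i}$ for each $i$, and put $I=\{k_1,\dots,k_m\}$. Then: (i) $\widehat R_f$ is the union of $m^{n-r}$ $\mathscr R^a$-classes of $P$. (ii) $\widehat L_f$ is the union of $\Lambda_I$ $\mathscr L^a$-classes of $P$. (iii) $\widehat H_f$ is the union of $m^{n-r}\Lambda_I$ $\mathscr H^a$-classes of $P$, each of which has size $m!$. The map $\phi:P\to\mathcal T_A$ is injective when restricted to any $\mathscr H^a$-class of $P$. (iv) If $H_{\overline f}$ is a non-group $\mathscr H$-class of $\mathcal T_A$, then each $\mathscr H^a$-class of $P$ contained in $\widehat H_f$ is a non-group. (v) If $H_{\overline f}$ is a group $\mathscr H$-class of $\mathcal T_A$, then each $\mathscr H^a$-class of $P$ contained in $\widehat H_f$ is a group isomorphic to the symmetric group $\mathcal S_m$. Further, $\widehat H_f$ is a rectangular group; specifically, $\widehat H_f$ is isomorphic to a direct product of an $m^{n-r}\times\Lambda_I$ rectangular band with $\mathcal S_m$. (vi) $\widehat{\mathscr D}=\mathscr D^a$, so $\widehat D_f=D_f^a=D_m^a=\{g\in P:\operatorname{rank}(g)=m\}$ is the union of: (a) $m^{n-r}S(r,m)$ $\mathscr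 R^a$-classes of $P$; (b) $\sum_{J\in\binom{\mathbf r}{m}}\Lambda_J$ $\mathscr L^a$-classes of $P$; (c) $m^{n-r}S(r,m)\sum_{J\in\binom{\mathbf r}{m}}\Lambda_J$ $\mathscr H^a$-classes of $P$.
   Context: For a set $Y$, $\mathcal T_Y$ is the full transformation semigroup of all maps $Y\to Y$ under composition; maps are written on the right and composed from left to right. $\operatorname{rank}(f)=|\operatorname{im}(f)|$, $\ker(f)=\{(x,y):xf=yf\}$. The variant $\mathcal T_X^a$ is $\mathcal T_X$ with operation $f\star g=fag$; $P=\operatorname{Reg}(\mathcal T_X^a)=\{f\in\mathcal T_X:\operatorname{rank}(afa)=\operatorname{rank}(f)\}$, the set of regular elements of $\mathcal T_X^a$, is a subsemigroup of $\mathcal T_X^a$. Put $A=\operatorname{im}(a)$. $\mathscr R^a,\mathscr L^a,\mathscr H^a,\mathscr D^a$ denote Green's relations on the semigroup $P$ (under $\star$), and $D_f^a$ is the $\mathscr D^a$-class of $f$ in $P$. For $m\in\{1,\dots,r\}$, $D_m^a=\{g\in P:\operatorname{rank}(g)=m\}$. The map $\phi:P\to\mathcal T_A:f\mapsto(fa)|_A$ is a surjective homomorphism, and $\overline f=f\phi$. For $\mathscr K\in\{\mathscr L,\mathscr R,\mathscr H,\mathscr D\}$, the relation $\widehat{\mathscr K}$ on $P$ is defined by $f\mathrel{\widehat{\mathscr K}}g\iff\overline f\mathrel{\mathscr K}\overline g$ in $\mathcal T_A$ (with $\mathscr K$ Green's relation on $\mathcal T_A$), and $\widehat K_f$ is the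 $\widehat{\mathscr K}$-class of $f$ in $P$; $H_{\overline f}$ is the $\mathscr H$-class of $\overline f$ in $\mathcal T_A$. $\mathbf r=\{1,\dots,r\}$; $\binom{\mathbf r}{m}$ is the set of $m$-element subsets of $\mathbf r$; $\Lambda_J=\prod_{j\in J}\lambda_j$ for $J\subseteq\mathbf r$; $S(r,m)$ is the Stirling number of the second kind. A $p\times q$ rectangular band is a semigroup $K\times L$ with $|K|=p$, $|L|=q$ and product $(i_1,j_1)(i_2,j_2)=(i_1,j_2)$; a rectangular group is a direct product of a rectangular band and a group. *)

theory Defs
  imports "HOL-Algebra.Sym_Groups" "HOL-Combinatorics.Stirling"
begin

text \<open>
  A semigroup is a \<^typ>\<open>'s monoid\<close> record of which only carrier and product matter. The field
  \<open>one\<close> is the two-sided identity if there is one, and unspecified otherwise; hence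
  \<open>group (semigroup_of S f)\<close> says that \<open>S\<close> is closed under \<open>f\<close> and is a group under it.
\<close>

definition semigroup_of :: "'s set \<Rightarrow> ('s \<Rightarrow> 's \<Rightarrow> 's) \<Rightarrow> 's monoid" where
  "semigroup_of S f =
     \<lparr> carrier = S, mult = f, one = (THE e. e \<in> S \<and> (\<forall>x\<in>S. f e x = x \<and> f x e = x)) \<rparr>"

definition is_semigroup :: "'s monoid \<Rightarrow> bool" where
  "is_semigroup G \<longleftrightarrow>
     (\<forall>x\<in>carrier G. \<forall>y\<in>carrier G. x \<otimes>\<^bsub>G\<^esub> y \<in> carrier G) \<and>
     (\<forall>x\<in>carrier G. \<forall>y\<in>carrier G. \<forall>z\<in>carrier G.
        (x \<otimes>\<^bsub>G\<^esub> y) \<otimes>\<^bsub>G\<^esub> z = x \<otimes>\<^bsub>G\<^esub> (y \<otimes>\<^bsub>G\<^esub> z))"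

definition restrict_to :: "'s monoid \<Rightarrow> 's set \<Rightarrow> 's monoid" where
  "restrict_to G H = semigroup_of H (mult G)"

definition Reg :: "'s monoid \<Rightarrow> 's set" where
  "Reg G = {x \<in> carrier G. \<exists>y\<in>carrier G. x = x \<otimes>\<^bsub>G\<^esub> y \<otimes>\<^bsub>G\<^esub> x}"

text \<open>Principal one-sided ideals \<open>x G\<^sup>1\<close> and \<open>G\<^sup>1 x\<close>.\<close>

definition right_ideal :: "'s monoid \<Rightarrow> 's \<Rightarrow> 's set" where
  "right_ideal G x = insert x {x \<otimes>\<^bsub>G\<^esub> s | s. s \<in> carrier G}"

definition left_ideal :: "'s monoid \<Rightarrow> 's \<Rightarrow> 's set" where
  "left_ideal G x = insert x {s \<otimes>\<^bsub>G\<^esub> x | s. s \<in> carrier G}"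

definition green_R :: "'s monoid \<Rightarrow> 's rel" where
  "green_R G = {(x, y). x \<in> carrier G \<and> y \<in> carrier G \<and> right_ideal G x = right_ideal G y}"

definition green_L :: "'s monoid \<Rightarrow> 's rel" where
  "green_L G = {(x, y). x \<in> carrier G \<and> y \<in> carrier G \<and> left_ideal G x = left_ideal G y}"

definition green_H :: "'s monoid \<Rightarrow> 's rel" where
  "green_H G = green_R G \<inter> green_L G"

text \<open>
  The join of \<open>green_R\<close> and \<open>green_L\<close> among the equivalence relations on the carrier: both are
  equivalences there, so the transitive closure of their union is already one.
\<close>

definition green_D :: "'s monoid \<Rightarrow> 's rel" where
  "green_D G = (green_R G \<union> green_L G)\<^sup>+"

definition rectangular_band :: "'k set \<Rightarrow> 'l set \<Rightarrow> ('k \<times> 'l) monoid" where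
  "rectangular_band K L = semigroup_of (K \<times> L) (\<lambda>(i1, j1) (i2, j2). (i1, j2))"

text \<open>
  \<open>S\<close> is a rectangular group, as the direct product of the \<open>K \<times> L\<close> rectangular band and the
  group \<open>B\<close>. Closure of \<open>S\<close> is required explicitly because \<open>iso\<close> does not entail it.
\<close>

definition rectangular_group :: "'s monoid \<Rightarrow> 'k set \<Rightarrow> 'l set \<Rightarrow> 'g monoid \<Rightarrow> bool" where
  "rectangular_group S K L B \<longleftrightarrow>
     is_semigroup S \<and> group B \<and> S \<cong> rectangular_band K L \<times>\<times> B"

text \<open>
  Maps \<open>Y \<rightarrow> Y\<close> are extensional functions (\<open>undefined\<close> outside \<open>Y\<close>). They compose from left to
  right: the product of \<open>f\<close> and \<open>g\<close> applies \<open>f\<close> first.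
\<close>

definition full_trans :: "'a set \<Rightarrow> ('a \<Rightarrow> 'a) monoid" where
  "full_trans Y = semigroup_of (Y \<rightarrow>\<^sub>E Y) (\<lambda>f g. compose Y g f)"

definition map_rank :: "'a set \<Rightarrow> ('a \<Rightarrow> 'a) \<Rightarrow> nat" where
  "map_rank Y f = card (f ` Y)"

definition map_ker :: "'a set \<Rightarrow> ('a \<Rightarrow> 'a) \<Rightarrow> 'a rel" where
  "map_ker Y f = {(x, y). x \<in> Y \<and> y \<in> Y \<and> f x = f y}"

definition variant :: "'a set \<Rightarrow> ('a \<Rightarrow> 'a) \<Rightarrow> ('a \<Rightarrow> 'a) monoid" where
  "variant X a = semigroup_of (X \<rightarrow>\<^sub>E X) (\<lambda>f g. f \<otimes>\<^bsub>full_trans X\<^esub> a \<otimes>\<^bsub>full_trans X\<^esub> g)"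

definition reg_variant :: "'a set \<Rightarrow> ('a \<Rightarrow> 'a) \<Rightarrow> ('a \<Rightarrow> 'a) monoid" where
  "reg_variant X a = restrict_to (variant X a) (Reg (variant X a))"

definition phi :: "'a set \<Rightarrow> ('a \<Rightarrow> 'a) \<Rightarrow> ('a \<Rightarrow> 'a) \<Rightarrow> ('a \<Rightarrow> 'a)" where
  "phi X a f = restrict (f \<otimes>\<^bsub>full_trans X\<^esub> a) (a ` X)"

text \<open>\<open>hat X a K\<close> is the pullback along \<open>phi X a\<close> of Green's relation \<open>K\<close> on \<open>full_trans (a ` X)\<close>.\<close>

definition hat ::
  "'a set \<Rightarrow> ('a \<Rightarrow> 'a) \<Rightarrow> (('a \<Rightarrow> 'a) monoid \<Rightarrow> ('a \<Rightarrow> 'a) rel) \<Rightarrow> ('a \<Rightarrow> 'a) rel" where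
  "hat X a K = {(f, g). f \<in> carrier (reg_variant X a) \<and> g \<in> carrier (reg_variant X a) \<and>
                        (phi X a f, phi X a g) \<in> K (full_trans (a ` X))}"

definition is_union_of :: "'b set \<Rightarrow> nat \<Rightarrow> 'b set set \<Rightarrow> bool" where
  "is_union_of E N C \<longleftrightarrow> (\<exists>D \<subseteq> C. finite D \<and> card D = N \<and> E = \<Union>D)"

end

theory Submission
  imports Defs
begin

text \<open>Write \<open>A = a ` X\<close>. A map \<open>f\<close> is regular in the variant exactly if \<open>f ` A = f ` X\<close> and \<open>a\<close> is injective on
\<open>f ` X\<close> (\<open>carrier_P\<close>). In \<open>P\<close> two maps are R-related iff they have the same kernel on \<open>X\<close>, L-related iff
they have the same image, and D-related iff they have the same rank (\<open>green_R_P\<close>, \<open>green_L_P\<close>,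
\<open>green_D_P\<close>). The same description for the full transformation semigroup of \<open>A\<close> is the special case
of the variant by the identity. Since \<open>a\<close> is injective on images of regular maps, the pullbacks
along \<open>phi\<close> are given by the kernel on \<open>A\<close>, by the set \<open>a ` f ` X\<close>, and by the rank; in particular
the pullback of D is D.

Counting classes is therefore counting kernels and images. A kernel in the pulled back R-class of
\<open>f\<close> amounts to an extension of the kernel on \<open>A\<close>, that is, to an assignment of one of \<open>m\<close> classes to
each of the \<open>n - r\<close> points outside \<open>A\<close> (\<open>card_kernels_hat_R\<close>). An image in the pulled back L-class
is a transversal of the fibres of \<open>a\<close> over \<open>a ` f ` X\<close> (\<open>images_hat_L\<close>). For the whole D-class, one
counts in addition the partitions of \<open>A\<close> into \<open>m\<close> classes and the \<open>m\<close>-subsets of \<open>A\<close>. Kernel and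
image can be prescribed independently (\<open>ex_ker_im_P\<close>), so numbers of H-classes are products.

An H-class consists of the composites of one map with the permutations of its image, hence has \<open>m!\<close>
elements. It is a group iff \<open>f\<close> is injective on \<open>B = a ` f ` X\<close>, which is the condition for the
H-class of \<open>phi X a f\<close> as well (\<open>H_class_group_iff\<close>, \<open>phi_H_class_group_iff\<close>). In this case every member
of the pulled back H-class factors uniquely as \<open>s \<circ> \<pi> \<circ> w\<close> with a retraction \<open>w\<close> onto \<open>B\<close>, a
permutation \<open>\<pi>\<close> of \<open>B\<close> and a section \<open>s\<close> of \<open>a\<close> over \<open>B\<close>. As \<open>w \<circ> a \<circ> s\<close> is always the identity on
\<open>B\<close>, multiplication keeps \<open>w\<close> from the first factor and \<open>s\<close> from the second and composes the
permutations, which is the asserted rectangular group (\<open>rectangular_group_hat_H\<close>).\<close>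

section \<open>Counting maps and transversals\<close>

text \<open>The surjections onto a set with \<open>m\<close> elements stand for the partitions into \<open>m\<close> classes, each of
which is counted \<open>m!\<close> times, once for every labelling of its classes.\<close>
lemma card_surjections:
  assumes "finite A" and "finite B"
  shows "card {f \<in> A \<rightarrow>\<^sub>E B. f ` A = B} = fact (card B) * Stirling (card A) (card B)"
  using assms
proof (induction A arbitrary: B rule: finite_induct)
  case empty
  show ?case
  proof (cases "B = {}")
    case True
    then have "{f \<in> {} \<rightarrow>\<^sub>E B. f ` {} = B} = {\<lambda>_. undefined}" by auto
    then show ?thesis using True by simp
  next
    case False
    then have "card B \<noteq> 0" using empty by simp
    then obtain c where "card B = Suc c" by (cases "card B") auto
    moreover have "{f \<in> {} \<rightarrow>\<^sub>E B. f ` {} = B} = {}" using False by auto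
    ultimately show ?thesis by simp
  qed
next
  case (insert x A)
  let ?S = "\<lambda>A B. {f \<in> A \<rightarrow>\<^sub>E B. f ` A = B}"
  have fin: "finite (?S A C)" if "finite C" for C
    using that insert.hyps by (simp add: finite_PiE)
  \<comment> \<open>a surjection is cut into its value \<open>y\<close> at \<open>x\<close> and its restriction, onto \<open>B\<close> or \<open>B - {y}\<close>\<close>
  have "bij_betw (\<lambda>(y, f). f(x := y)) (SIGMA y:B. ?S A B \<union> ?S A (B - {y})) (?S (insert x A) B)"
  proof (rule bij_betw_byWitness[where f' = "\<lambda>g. (g x, restrict g A)"])
    show "\<forall>p\<in>SIGMA y:B. ?S A B \<union> ?S A (B - {y}).
            (\<lambda>g. (g x, restrict g A)) ((\<lambda>(y, f). f(x := y)) p) = p"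
      using insert.hyps(2) by (auto simp: fun_eq_iff restrict_def PiE_def extensional_def)
    show "\<forall>g\<in>?S (insert x A) B. (\<lambda>(y, f). f(x := y)) (g x, restrict g A) = g"
      by (auto simp: fun_eq_iff restrict_def PiE_def extensional_def)
    show "(\<lambda>(y, f). f(x := y)) ` (SIGMA y:B. ?S A B \<union> ?S A (B - {y})) \<subseteq> ?S (insert x A) B"
    proof -
      have "f(x := y) \<in> ?S (insert x A) B" if y: "y \<in> B" and f: "f \<in> ?S A B \<union> ?S A (B - {y})" for y f
      proof -
        have "f \<in> A \<rightarrow>\<^sub>E B" and "insert y (f ` A) = B" using f y by (auto simp: PiE_def)
        then show ?thesis using insert.hyps(2) y
          by (auto simp: PiE_def extensional_def fun_upd_image)
      qed
      then show ?thesis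
        by (intro image_subsetI) (elim SigmaE, simp only: prod.case)
    qed
    show "(\<lambda>g. (g x, restrict g A)) ` ?S (insert x A) B \<subseteq> (SIGMA y:B. ?S A B \<union> ?S A (B - {y}))"
    proof (rule image_subsetI)
      fix g assume g: "g \<in> ?S (insert x A) B"
      then have "B = insert (g x) (g ` A)" by auto
      then have "g ` A = B \<or> g ` A = B - {g x}" by blast
      moreover have "restrict g A \<in> A \<rightarrow>\<^sub>E g ` A" by auto
      ultimately show "(g x, restrict g A) \<in> (SIGMA y:B. ?S A B \<union> ?S A (B - {y}))"
        using \<open>B = insert (g x) (g ` A)\<close> by auto
    qed
  qed
  then have "card (?S (insert x A) B) = card (SIGMA y:B. ?S A B \<union> ?S A (B - {y}))"
    by (simp add: bij_betw_same_card)
  also have "\<dots> = (\<Sum>y\<in>B. card (?S A B \<union> ?S A (B - {y})))"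
    using fin insert.prems by (intro card_SigmaI) auto
  also have "\<dots> = (\<Sum>y\<in>B. card (?S A B) + card (?S A (B - {y})))"
    using fin insert.prems by (intro sum.cong refl card_Un_disjoint) auto
  also have "\<dots> = (\<Sum>y\<in>B. fact (card B) * Stirling (card A) (card B)
                         + fact (card B - 1) * Stirling (card A) (card B - 1))"
    using insert.IH insert.prems by (intro sum.cong refl) simp
  also have "\<dots> = fact (card B) * Stirling (card (insert x A)) (card B)"
    using insert.hyps by (cases "card B") (simp_all add: algebra_simps)
  finally show ?case .
qed

lemma card_extensions:
  assumes "finite X" and "A \<subseteq> X" and "Q \<subseteq> A \<rightarrow>\<^sub>E Y"
  shows "card {g \<in> X \<rightarrow>\<^sub>E Y. restrict g A \<in> Q} = card Q * card Y ^ card (X - A)"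
proof -
  have "bij_betw (\<lambda>g. (restrict g A, restrict g (X - A)))
          {g \<in> X \<rightarrow>\<^sub>E Y. restrict g A \<in> Q} (Q \<times> ((X - A) \<rightarrow>\<^sub>E Y))"
  proof (rule bij_betw_byWitness[where f' = "\<lambda>(p, q) x. if x \<in> A then p x else q x"])
    show "\<forall>g\<in>{g \<in> X \<rightarrow>\<^sub>E Y. restrict g A \<in> Q}.
            (\<lambda>(p, q) x. if x \<in> A then p x else q x) (restrict g A, restrict g (X - A)) = g"
      using assms(2) by (auto simp: fun_eq_iff PiE_def extensional_def)
    have *: "restrict (\<lambda>x. if x \<in> A then p x else q x) A = p" if "p \<in> Q" for p q :: "'a \<Rightarrow> 'b"
      using that assms(3) by (auto simp: fun_eq_iff PiE_def extensional_def)
    then show "\<forall>pq\<in>Q \<times> ((X - A) \<rightarrow>\<^sub>E Y). (\<lambda>g. (restrict g A, restrict g (X - A)))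
                 ((\<lambda>(p, q) x. if x \<in> A then p x else q x) pq) = pq"
      by (auto simp: fun_eq_iff PiE_def extensional_def)
    show "(\<lambda>g. (restrict g A, restrict g (X - A))) ` {g \<in> X \<rightarrow>\<^sub>E Y. restrict g A \<in> Q}
            \<subseteq> Q \<times> ((X - A) \<rightarrow>\<^sub>E Y)"
      by auto
    show "(\<lambda>(p, q) x. if x \<in> A then p x else q x) ` (Q \<times> ((X - A) \<rightarrow>\<^sub>E Y))
            \<subseteq> {g \<in> X \<rightarrow>\<^sub>E Y. restrict g A \<in> Q}"
      using * assms(2,3) by (auto simp: PiE_def Pi_def extensional_def subset_iff)
  qed
  then show ?thesis
    using assms(1) by (simp add: bij_betw_same_card card_cartesian_product card_funcsetE)
qed

text \<open>The sets \<open>Y\<close> below are those with exactly one point in each fibre of \<open>a\<close> over \<open>B\<close>.\<close>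
lemma card_transversals:
  assumes "finite B"
  shows "card {Y. Y \<subseteq> X \<and> inj_on a Y \<and> a ` Y = B} = (\<Prod>b\<in>B. card {x \<in> X. a x = b})"
proof -
  have "bij_betw (\<lambda>s. s ` B) (PiE B (\<lambda>b. {x \<in> X. a x = b})) {Y. Y \<subseteq> X \<and> inj_on a Y \<and> a ` Y = B}"
    unfolding bij_betw_def
  proof
    show "inj_on (\<lambda>s. s ` B) (PiE B (\<lambda>b. {x \<in> X. a x = b}))"
    proof (rule inj_onI)
      fix s t assume s: "s \<in> (\<Pi>\<^sub>E b\<in>B. {x \<in> X. a x = b})" and t: "t \<in> (\<Pi>\<^sub>E b\<in>B. {x \<in> X. a x = b})"
        and eq: "s ` B = t ` B"
      show "s = t"
      proof (rule PiE_ext[OF s t])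
        fix b assume b: "b \<in> B"
        then obtain c where c: "c \<in> B" "s b = t c" using eq by blast
        then have "a (s b) = b" "a (t c) = c" using PiE_mem[OF s b] PiE_mem[OF t c(1)] by auto
        then show "s b = t b" using c by simp
      qed
    qed
    show "(\<lambda>s. s ` B) ` (PiE B (\<lambda>b. {x \<in> X. a x = b})) = {Y. Y \<subseteq> X \<and> inj_on a Y \<and> a ` Y = B}"
    proof safe
      fix s assume s: "s \<in> (\<Pi>\<^sub>E b\<in>B. {x \<in> X. a x = b})"
      then have *: "s b \<in> X" "a (s b) = b" if "b \<in> B" for b using that by (auto dest!: PiE_mem)
      show "\<And>b. b \<in> B \<Longrightarrow> s b \<in> X" by (fact *)
      show "inj_on a (s ` B)" using * by (auto intro!: inj_onI)
      show "\<And>b. b \<in> B \<Longrightarrow> a (s b) \<in> B" using * by simp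
      show "\<And>b. b \<in> B \<Longrightarrow> b \<in> a ` s ` B" using * by force
    next
      fix Y assume Y: "Y \<subseteq> X" "inj_on a Y" "B = a ` Y"
      have "Y = restrict (inv_into Y a) (a ` Y) ` a ` Y" using Y by (auto simp: image_iff)
      moreover have "restrict (inv_into Y a) (a ` Y) \<in> (\<Pi>\<^sub>E b\<in>a ` Y. {x \<in> X. a x = b})"
        using Y by auto
      ultimately show "Y \<in> (\<lambda>s. s ` (a ` Y)) ` (\<Pi>\<^sub>E b\<in>a ` Y. {x \<in> X. a x = b})"
        by (rule image_eqI)
    qed
  qed
  then show ?thesis using assms by (simp add: bij_betw_same_card[symmetric] card_PiE)
qed

lemma card_partial_transversals:
  assumes "finite X"
  shows "card {Y. Y \<subseteq> X \<and> inj_on a Y \<and> card Y = m}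
       = (\<Sum>B | B \<subseteq> a ` X \<and> card B = m. \<Prod>b\<in>B. card {x \<in> X. a x = b})"
proof -
  have eq: "{Y. Y \<subseteq> X \<and> inj_on a Y \<and> card Y = m} =
          (\<Union>B\<in>{B. B \<subseteq> a ` X \<and> card B = m}. {Y. Y \<subseteq> X \<and> inj_on a Y \<and> a ` Y = B})"
    by (auto simp: card_image image_mono)
  have finB: "finite B" if "B \<subseteq> a ` X" for B using that assms finite_surj by blast
  have "card {Y. Y \<subseteq> X \<and> inj_on a Y \<and> card Y = m}
      = (\<Sum>B | B \<subseteq> a ` X \<and> card B = m. card {Y. Y \<subseteq> X \<and> inj_on a Y \<and> a ` Y = B})"
    unfolding eq using assms by (intro card_UN_disjoint) auto
  also have "\<dots> = (\<Sum>B | B \<subseteq> a ` X \<and> card B = m. \<Prod>b\<in>B. card {x \<in> X. a x = b})"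
    using finB by (intro sum.cong refl card_transversals) auto
  finally show ?thesis .
qed

section \<open>Counting equivalence classes by an invariant\<close>

lemma card_eq_card_image_mult:
  assumes "finite S" and "\<And>x. x \<in> S \<Longrightarrow> card {y \<in> S. \<kappa> y = \<kappa> x} = c"
  shows "card S = card (\<kappa> ` S) * c"
proof -
  have "card S = (\<Sum>k\<in>\<kappa> ` S. card {y \<in> S. \<kappa> y = k})"
    using sum.image_gen[OF assms(1), of "\<lambda>_. 1 :: nat" \<kappa>] by simp
  also have "\<dots> = (\<Sum>k\<in>\<kappa> ` S. c)" using assms(2) by (intro sum.cong) auto
  finally show ?thesis by simp
qed

text \<open>All of Green's relations met here have the form \<open>\<kappa> x = \<kappa> y\<close>; counting classes then means
counting values of the invariant \<open>\<kappa>\<close>.\<close>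
lemma is_union_of_invariant:
  assumes E: "E = {(x, y). x \<in> C \<and> y \<in> C \<and> \<kappa> x = \<kappa> y}" and "finite S" and "S \<subseteq> C"
    and sat: "\<And>x y. x \<in> S \<Longrightarrow> y \<in> C \<Longrightarrow> \<kappa> x = \<kappa> y \<Longrightarrow> y \<in> S"
  shows "is_union_of S (card (\<kappa> ` S)) (C // E)"
proof -
  have cls: "E `` {x} = {y \<in> C. \<kappa> y = \<kappa> x}" if "x \<in> C" for x using that by (auto simp: E)
  have "inj_on (\<lambda>k. {y \<in> C. \<kappa> y = k}) (\<kappa> ` S)"
  proof (rule inj_onI)
    fix k l assume "k \<in> \<kappa> ` S" "{y \<in> C. \<kappa> y = k} = {y \<in> C. \<kappa> y = l}"
    then show "k = l" using \<open>S \<subseteq> C\<close> by fastforce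
  qed
  then have "card ((\<lambda>k. {y \<in> C. \<kappa> y = k}) ` \<kappa> ` S) = card (\<kappa> ` S)" by (rule card_image)
  moreover have "(\<lambda>k. {y \<in> C. \<kappa> y = k}) ` \<kappa> ` S = (\<lambda>x. E `` {x}) ` S"
    using cls \<open>S \<subseteq> C\<close> by (auto simp: image_image subset_iff intro!: image_cong)
  ultimately have "card ((\<lambda>x. E `` {x}) ` S) = card (\<kappa> ` S)" by simp
  moreover have "(\<lambda>x. E `` {x}) ` S \<subseteq> C // E" using \<open>S \<subseteq> C\<close> by (auto simp: quotient_def)
  moreover have "S = \<Union> ((\<lambda>x. E `` {x}) ` S)"
  proof
    show "S \<subseteq> \<Union> ((\<lambda>x. E `` {x}) ` S)" using \<open>S \<subseteq> C\<close> by (auto simp: E)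
    show "\<Union> ((\<lambda>x. E `` {x}) ` S) \<subseteq> S" using sat by (auto simp: E)
  qed
  ultimately show ?thesis unfolding is_union_of_def using \<open>finite S\<close> by (metis finite_imageI)
qed

section \<open>Kernels of maps\<close>

lemma map_ker_eq_iff:
  "map_ker Y f = map_ker Y g \<longleftrightarrow> (\<forall>x\<in>Y. \<forall>y\<in>Y. f x = f y \<longleftrightarrow> g x = g y)"
  unfolding map_ker_def by auto

lemma map_ker_eqD:
  assumes "map_ker Y f = map_ker Y g" "x \<in> Y" "y \<in> Y"
  shows "f x = f y \<longleftrightarrow> g x = g y"
  using assms unfolding map_ker_eq_iff by blast

lemma map_ker_eq_factor:
  assumes "map_ker Y f = map_ker Y g"
  obtains \<beta> where "bij_betw \<beta> (f ` Y) (g ` Y)" and "\<And>x. x \<in> Y \<Longrightarrow> \<beta> (f x) = g x"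
proof
  let ?\<beta> = "\<lambda>y. g (inv_into Y f y)"
  show b: "?\<beta> (f x) = g x" if "x \<in> Y" for x
    using assms that unfolding map_ker_eq_iff by (meson f_inv_into_f image_eqI inv_into_into)
  show "bij_betw ?\<beta> (f ` Y) (g ` Y)"
    unfolding bij_betw_def
  proof
    show "inj_on ?\<beta> (f ` Y)"
    proof (rule inj_onI)
      fix u v assume "u \<in> f ` Y" "v \<in> f ` Y" and eq: "?\<beta> u = ?\<beta> v"
      then obtain x y where "x \<in> Y" "u = f x" "y \<in> Y" "v = f y" by blast
      then show "u = v" using b eq assms unfolding map_ker_eq_iff by metis
    qed
    show "?\<beta> ` f ` Y = g ` Y" using b by (simp add: image_image cong: image_cong_simp)
  qed
qed

lemma map_ker_eq_rank:
  assumes "map_ker Y f = map_ker Y g" shows "map_rank Y f = map_rank Y g"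
  unfolding map_rank_def by (rule map_ker_eq_factor[OF assms]) (rule bij_betw_same_card)

section \<open>Semigroups given by a carrier and a product\<close>

lemma right_ideal_eqI:
  assumes "is_semigroup G" and "x \<in> carrier G" "y \<in> carrier G" "s \<in> carrier G" "t \<in> carrier G"
    and "x = y \<otimes>\<^bsub>G\<^esub> s" "y = x \<otimes>\<^bsub>G\<^esub> t"
  shows "right_ideal G x = right_ideal G y"
proof -
  have *: "right_ideal G u \<subseteq> right_ideal G v"
    if "u = v \<otimes>\<^bsub>G\<^esub> w" "u \<in> carrier G" "v \<in> carrier G" "w \<in> carrier G" for u v w
    using assms(1) that unfolding right_ideal_def is_semigroup_def by auto
  show ?thesis using *[of x y s] *[of y x t] assms by blast
qed

lemma left_ideal_eqI:
  assumes "is_semigroup G" and "x \<in> carrier G" "y \<in> carrier G" "s \<in> carrier G" "t \<in> carrier G"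
    and "x = s \<otimes>\<^bsub>G\<^esub> y" "y = t \<otimes>\<^bsub>G\<^esub> x"
  shows "left_ideal G x = left_ideal G y"
proof -
  have *: "left_ideal G u \<subseteq> left_ideal G v"
    if "u = w \<otimes>\<^bsub>G\<^esub> v" "u \<in> carrier G" "v \<in> carrier G" "w \<in> carrier G" for u v w
  proof -
    have "s \<otimes>\<^bsub>G\<^esub> u = (s \<otimes>\<^bsub>G\<^esub> w) \<otimes>\<^bsub>G\<^esub> v \<and> s \<otimes>\<^bsub>G\<^esub> w \<in> carrier G" if "s \<in> carrier G" for s
      using assms(1) that \<open>w \<in> carrier G\<close> \<open>v \<in> carrier G\<close> \<open>u = _\<close>
      by (simp add: is_semigroup_def)
    then show ?thesis using that unfolding left_ideal_def by blast
  qed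
  show ?thesis using *[of x s y] *[of y t x] assms by blast
qed

lemma semigroup_of_simps [simp]:
  "carrier (semigroup_of S f) = S" "mult (semigroup_of S f) = f"
  by (simp_all add: semigroup_of_def)

text \<open>The bijection runs from the known structure to the one to be identified, so that closure has
to be known on the side of \<open>G\<close> only.\<close>
lemma semigroup_of_transport:
  assumes bij: "bij_betw h (carrier G) S"
    and hom: "\<And>x y. x \<in> carrier G \<Longrightarrow> y \<in> carrier G \<Longrightarrow> h (x \<otimes>\<^bsub>G\<^esub> y) = f (h x) (h y)"
    and cl: "\<And>x y. x \<in> carrier G \<Longrightarrow> y \<in> carrier G \<Longrightarrow> x \<otimes>\<^bsub>G\<^esub> y \<in> carrier G"
  shows "semigroup_of S f \<cong> G"
proof -
  let ?k = "inv_into (carrier G) h"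
  have k: "?k u \<in> carrier G" "h (?k u) = u" if "u \<in> S" for u
    using that bij unfolding bij_betw_def by (auto intro: inv_into_into f_inv_into_f)
  have kh: "?k (h x) = x" if "x \<in> carrier G" for x
    using that bij by (simp add: bij_betw_inv_into_left)
  have "?k (f u v) = ?k u \<otimes>\<^bsub>G\<^esub> ?k v" if "u \<in> S" "v \<in> S" for u v
    using kh[OF cl[OF k(1)[OF that(1)] k(1)[OF that(2)]]] hom[OF k(1)[OF that(1)] k(1)[OF that(2)]]
      k that by simp
  then have "?k \<in> iso (semigroup_of S f) G"
    using bij k unfolding iso_def hom_def semigroup_of_def by (auto simp: bij_betw_inv_into)
  then show ?thesis unfolding is_iso_def by blast
qed

lemma group_semigroup_of_transport:
  assumes "group G" and bij: "bij_betw h (carrier G) S"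
    and hom: "\<And>x y. x \<in> carrier G \<Longrightarrow> y \<in> carrier G \<Longrightarrow> h (x \<otimes>\<^bsub>G\<^esub> y) = f (h x) (h y)"
  shows "group (semigroup_of S f)"
proof -
  interpret group G by fact
  let ?H = "semigroup_of S f"
  have S: "S = h ` carrier G" using bij by (simp add: bij_betw_def)
  have unit: "f (h \<one>\<^bsub>G\<^esub>) u = u \<and> f u (h \<one>\<^bsub>G\<^esub>) = u" if "u \<in> S" for u
    using that unfolding S by (auto simp flip: hom)
  have "(THE e. e \<in> S \<and> (\<forall>u\<in>S. f e u = u \<and> f u e = u)) = h \<one>\<^bsub>G\<^esub>"
  proof (rule the_equality)
    show "h \<one>\<^bsub>G\<^esub> \<in> S \<and> (\<forall>u\<in>S. f (h \<one>\<^bsub>G\<^esub>) u = u \<and> f u (h \<one>\<^bsub>G\<^esub>) = u)" using unit S by auto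
    show "e = h \<one>\<^bsub>G\<^esub>" if "e \<in> S \<and> (\<forall>u\<in>S. f e u = u \<and> f u e = u)" for e
      using that unit S by (metis one_closed image_eqI)
  qed
  then have one: "\<one>\<^bsub>?H\<^esub> = h \<one>\<^bsub>G\<^esub>" by (simp add: semigroup_of_def)
  show ?thesis
  proof (rule groupI)
    fix x assume "x \<in> carrier ?H"
    then obtain g where "g \<in> carrier G" "x = h g" by (auto simp: S)
    then show "\<exists>y\<in>carrier ?H. y \<otimes>\<^bsub>?H\<^esub> x = \<one>\<^bsub>?H\<^esub>"
      by (intro bexI[of _ "h (inv\<^bsub>G\<^esub> g)"]) (auto simp: one[unfolded S] S simp flip: hom)
  qed (auto simp: one[unfolded S] S m_assoc simp flip: hom)
qed

section \<open>The regular part of a variant and its Green relations\<close>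

text \<open>A finite set with an idempotent self-map. The map is required neither to be extensional nor to
differ from the identity: with \<open>a = (\<lambda>x. x)\<close> the regular part of the variant is the
full transformation semigroup itself, so everything below also applies to \<open>full_trans A\<close>.\<close>
locale idempotent_map =
  fixes X :: "'a set" and a :: "'a \<Rightarrow> 'a"
  assumes fin: "finite X"
    and maps: "x \<in> X \<Longrightarrow> a x \<in> X"
    and idem: "x \<in> X \<Longrightarrow> a (a x) = a x"
begin

abbreviation A :: "'a set" where "A \<equiv> a ` X"

abbreviation P :: "('a \<Rightarrow> 'a) monoid" where "P \<equiv> reg_variant X a"

lemma A_sub: "A \<subseteq> X" using maps by blast

lemma a_id: "x \<in> A \<Longrightarrow> a x = x" using idem by auto

lemma inj_on_A: "inj_on a A" by (metis a_id inj_onI)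

lemma mult_P: "f \<otimes>\<^bsub>P\<^esub> g = compose X g (compose X a f)"
  by (simp add: reg_variant_def restrict_to_def variant_def full_trans_def)

lemma mult_P_apply: "x \<in> X \<Longrightarrow> (f \<otimes>\<^bsub>P\<^esub> g) x = g (a (f x))"
  by (simp add: mult_P compose_def)

text \<open>The regular elements are the maps for which the image \<open>A\<close> of \<open>a\<close> meets every class of their
kernel, and whose image is a partial transversal of the kernel of \<open>a\<close>.\<close>
lemma carrier_P: "f \<in> carrier P \<longleftrightarrow> f \<in> X \<rightarrow>\<^sub>E X \<and> f ` A = f ` X \<and> inj_on a (f ` X)"
proof
  assume "f \<in> carrier P"
  then obtain h where f: "f \<in> X \<rightarrow>\<^sub>E X" and h: "h \<in> X \<rightarrow>\<^sub>E X"
    and eq: "f = compose X f (compose X a (compose X h (compose X a f)))"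
    by (auto simp: reg_variant_def restrict_to_def variant_def full_trans_def Reg_def)
  have reg: "f (a (h (a (f x)))) = f x" if "x \<in> X" for x
    using fun_cong[OF eq, of x] that by (simp add: compose_def)
  have X: "h (a (f x)) \<in> X" if "x \<in> X" for x
    using that f h maps by (meson PiE_mem)
  have "f ` X \<subseteq> f ` A" using reg X by (metis (no_types, lifting) image_eqI image_subsetI)
  then have "f ` A = f ` X" using A_sub by blast
  moreover have "inj_on a (f ` X)" using reg by (intro inj_onI) (metis imageE)
  ultimately show "f \<in> X \<rightarrow>\<^sub>E X \<and> f ` A = f ` X \<and> inj_on a (f ` X)" using f by simp
next
  assume *: "f \<in> X \<rightarrow>\<^sub>E X \<and> f ` A = f ` X \<and> inj_on a (f ` X)"
  then have f: "x \<in> X \<Longrightarrow> f x \<in> X" for x by auto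
  \<comment> \<open>\<open>h\<close> chooses preimages under \<open>f\<close> in \<open>A\<close>; the quasi-inverse first undoes \<open>a\<close> on the image of \<open>f\<close>\<close>
  define h where "h x = (if x \<in> f ` X then inv_into A f x else undefined)" for x
  define h' where "h' = (\<lambda>x\<in>X. if x \<in> a ` f ` X then h (inv_into (f ` X) a x) else x)"
  have h: "h y \<in> A" "f (h y) = y" if "y \<in> f ` X" for y
    using that * unfolding h_def by (auto simp: inv_into_into f_inv_into_f)
  have h'_eq: "h' (a (f x)) = h (f x)" if "x \<in> X" for x
    using that * f maps unfolding h'_def by (auto simp: inv_into_f_f)
  have "h' \<in> X \<rightarrow>\<^sub>E X"
  proof (rule PiE_I)
    fix x assume x: "x \<in> X"
    show "h' x \<in> X"
    proof (cases "x \<in> a ` f ` X")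
      case True
      then show ?thesis using h'_eq h(1) A_sub by auto
    qed (use x in \<open>simp add: h'_def\<close>)
  qed (simp add: h'_def)
  moreover have "f = compose X f (compose X a (compose X h' (compose X a f)))"
  proof
    fix x
    show "f x = compose X f (compose X a (compose X h' (compose X a f))) x"
    proof (cases "x \<in> X")
      case True
      then have "a (h' (a (f x))) = h (f x)" using h'_eq a_id[OF h(1)] by simp
      then show ?thesis using True h(2) by (simp add: compose_def)
    next
      case False
      then show ?thesis using * by (auto simp: compose_def PiE_def extensional_def)
    qed
  qed
  ultimately show "f \<in> carrier P" using *
    by (auto simp: reg_variant_def restrict_to_def variant_def full_trans_def Reg_def)
qed

lemma P_I:
  assumes "f \<in> extensional X" and "f ` X \<subseteq> X" and "f ` A = f ` X" and "inj_on a (f ` X)"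
  shows "f \<in> carrier P"
  using assms by (auto simp: carrier_P PiE_def)

lemma P_D:
  assumes "f \<in> carrier P"
  shows "f \<in> X \<rightarrow>\<^sub>E X" "f ` A = f ` X" "inj_on a (f ` X)" "f \<in> extensional X" "f ` X \<subseteq> X"
    and "\<And>x. x \<in> X \<Longrightarrow> f x \<in> X"
  using assms by (auto simp: carrier_P PiE_def)

lemma finite_P: "finite (carrier P)"
  by (rule finite_subset[of _ "X \<rightarrow>\<^sub>E X"]) (use fin P_D in \<open>auto simp: finite_PiE\<close>)

lemma image_mult_P: "(f \<otimes>\<^bsub>P\<^esub> g) ` X = g ` a ` f ` X"
  by (simp add: image_image mult_P_apply cong: image_cong)

lemma mult_P_closed:
  assumes f: "f \<in> carrier P" and g: "g \<in> carrier P"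
  shows "f \<otimes>\<^bsub>P\<^esub> g \<in> carrier P"
proof (rule P_I)
  show "f \<otimes>\<^bsub>P\<^esub> g \<in> extensional X" by (simp add: mult_P)
  have sub: "a ` f ` X \<subseteq> X" using P_D(6)[OF f] maps by auto
  then show "(f \<otimes>\<^bsub>P\<^esub> g) ` X \<subseteq> X" unfolding image_mult_P using P_D(6)[OF g] by auto
  show "(f \<otimes>\<^bsub>P\<^esub> g) ` A = (f \<otimes>\<^bsub>P\<^esub> g) ` X"
  proof -
    have "(f \<otimes>\<^bsub>P\<^esub> g) ` A = g ` a ` f ` A" by (simp add: image_image mult_P_apply maps cong: image_cong)
    then show ?thesis using P_D(2)[OF f] by (simp add: image_mult_P)
  qed
  show "inj_on a ((f \<otimes>\<^bsub>P\<^esub> g) ` X)" unfolding image_mult_P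
    using sub P_D(3)[OF g] by (meson image_mono inj_on_subset)
qed

lemma is_semigroup_P: "is_semigroup P"
proof -
  have "f \<otimes>\<^bsub>P\<^esub> g \<otimes>\<^bsub>P\<^esub> h = f \<otimes>\<^bsub>P\<^esub> (g \<otimes>\<^bsub>P\<^esub> h)" if "f \<in> carrier P" for f g h
    using P_D(6)[OF that] maps by (auto simp: mult_P compose_def fun_eq_iff)
  then show ?thesis using mult_P_closed by (simp add: is_semigroup_def)
qed

lemma P_ext:
  assumes "f \<in> carrier P" "g \<in> carrier P" "\<And>x. x \<in> X \<Longrightarrow> f x = g x"
  shows "f = g"
  by (rule extensionalityI[OF P_D(4)[OF assms(1)] P_D(4)[OF assms(2)]]) (rule assms(3))

lemma mult_P_eqI:
  assumes "f \<in> carrier P" "\<And>x. x \<in> X \<Longrightarrow> g (a (h x)) = f x"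
  shows "f = h \<otimes>\<^bsub>P\<^esub> g"
  by (rule extensionalityI[OF P_D(4)[OF assms(1)]]) (use assms(2) in \<open>simp_all add: mult_P compose_def\<close>)

text \<open>Divisibility in \<open>P\<close> itself: the multiplier has to be chosen regular as well. Here it sends
\<open>a (g x)\<close> to \<open>f x\<close> and every other point to one fixed value of \<open>f\<close>.\<close>
lemma right_dvd_P:
  assumes f: "f \<in> carrier P" and g: "g \<in> carrier P" and ker: "map_ker X f = map_ker X g"
  shows "\<exists>h\<in>carrier P. f = g \<otimes>\<^bsub>P\<^esub> h"
proof (cases "X = {}")
  case True
  then show ?thesis using f by (metis mult_P_eqI empty_iff)
next
  case False
  then obtain x0 where x0: "x0 \<in> X" by blast
  define h where "h = (\<lambda>x\<in>X. if x \<in> a ` g ` X then f (inv_into X (a \<circ> g) x) else f x0)"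
  have hg: "h (a (g x)) = f x" if x: "x \<in> X" for x
  proof -
    have "inv_into X (a \<circ> g) (a (g x)) \<in> X" "(a \<circ> g) (inv_into X (a \<circ> g) (a (g x))) = a (g x)"
      using x by (metis comp_apply image_eqI inv_into_into, metis comp_apply image_eqI f_inv_into_f)
    then have "f (inv_into X (a \<circ> g) (a (g x))) = f x"
      using x ker P_D(3)[OF g] unfolding map_ker_eq_iff inj_on_def by auto
    then show ?thesis using x P_D(6)[OF g] maps by (auto simp: h_def)
  qed
  have "h ` X \<subseteq> f ` X"
  proof
    fix y assume "y \<in> h ` X"
    then obtain x where x: "x \<in> X" "y = h x" by blast
    show "y \<in> f ` X"
    proof (cases "x \<in> a ` g ` X")
      case True
      then show ?thesis using x hg by auto
    qed (use x x0 in \<open>simp add: h_def\<close>)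
  qed
  moreover have "f ` X \<subseteq> h ` A" using hg P_D(6)[OF g] by (metis image_eqI image_subsetI)
  ultimately have im: "h ` X = f ` X" "h ` A = f ` X" using A_sub by blast+
  have "h \<in> carrier P" using im P_D[OF f] by (intro P_I) (auto simp: h_def)
  then show ?thesis using mult_P_eqI[OF f hg] by blast
qed

text \<open>The multiplier \<open>h\<close> sends \<open>x\<close> to a preimage of \<open>f x\<close> under \<open>g\<close> that lies in \<open>A\<close>, where \<open>a\<close> is
the identity.\<close>
lemma left_dvd_P:
  assumes f: "f \<in> carrier P" and g: "g \<in> carrier P" and im: "f ` X = g ` X"
  shows "\<exists>h\<in>carrier P. f = h \<otimes>\<^bsub>P\<^esub> g"
proof -
  define h where "h = (\<lambda>x\<in>X. inv_into A g (f x))"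
  have h: "h x \<in> A" "g (h x) = f x" if "x \<in> X" for x
  proof -
    have "f x \<in> g ` A" using that im P_D(2)[OF g] by blast
    then show "h x \<in> A" "g (h x) = f x"
      using that by (simp_all add: h_def inv_into_into f_inv_into_f)
  qed
  have "h \<in> carrier P"
  proof (rule P_I)
    show "h ` X \<subseteq> X" using h A_sub by blast
    have *: "h ` Y = inv_into A g ` f ` Y" if "Y \<subseteq> X" for Y
      unfolding h_def using that by (simp add: image_image subset_iff cong: image_cong)
    show "h ` A = h ` X" using *[OF A_sub] *[of X] P_D(2)[OF f] by simp
    show "inj_on a (h ` X)" using inj_on_subset[OF inj_on_A] h(1) by blast
  qed (simp add: h_def)
  moreover have "g (a (h x)) = f x" if "x \<in> X" for x using h[OF that] a_id[OF h(1)[OF that]] by simp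
  ultimately show ?thesis using mult_P_eqI[OF f] by blast
qed

lemma green_R_P:
  "green_R P = {(f, g). f \<in> carrier P \<and> g \<in> carrier P \<and> map_ker X f = map_ker X g}"
proof -
  have dvd: "map_ker X g \<subseteq> map_ker X f" if "f \<in> right_ideal P g" for f g
    using that by (auto simp: right_ideal_def map_ker_def mult_P_apply)
  have "map_ker X f = map_ker X g" if "right_ideal P f = right_ideal P g" for f g
    using dvd[of f g] dvd[of g f] that by (auto simp: right_ideal_def)
  moreover have "right_ideal P f = right_ideal P g"
    if "f \<in> carrier P" "g \<in> carrier P" "map_ker X f = map_ker X g" for f g
    using right_ideal_eqI[OF is_semigroup_P] right_dvd_P that by metis
  ultimately have "right_ideal P f = right_ideal P g \<longleftrightarrow> map_ker X f = map_ker X g"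
    if "f \<in> carrier P" "g \<in> carrier P" for f g using that by metis
  then show ?thesis by (simp add: green_R_def cong: conj_cong)
qed

lemma green_L_P:
  "green_L P = {(f, g). f \<in> carrier P \<and> g \<in> carrier P \<and> f ` X = g ` X}"
proof -
  have dvd: "f ` X \<subseteq> g ` X" if "f \<in> left_ideal P g" "g \<in> carrier P" for f g
  proof -
    have "f = g \<or> (\<exists>h\<in>carrier P. f = h \<otimes>\<^bsub>P\<^esub> g)" using that by (auto simp: left_ideal_def)
    moreover have "(h \<otimes>\<^bsub>P\<^esub> g) ` X \<subseteq> g ` X" if "h \<in> carrier P" for h
      unfolding image_mult_P using P_D(6)[OF that] maps by auto
    ultimately show ?thesis by blast
  qed
  have "f ` X = g ` X"
    if "left_ideal P f = left_ideal P g" "f \<in> carrier P" "g \<in> carrier P" for f g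
    using dvd[of f g] dvd[of g f] that by (auto simp: left_ideal_def)
  moreover have "left_ideal P f = left_ideal P g"
    if "f \<in> carrier P" "g \<in> carrier P" "f ` X = g ` X" for f g
    using left_ideal_eqI[OF is_semigroup_P] left_dvd_P that by metis
  ultimately have "left_ideal P f = left_ideal P g \<longleftrightarrow> f ` X = g ` X"
    if "f \<in> carrier P" "g \<in> carrier P" for f g using that by metis
  then show ?thesis by (simp add: green_L_def cong: conj_cong)
qed

lemma green_H_P:
  "green_H P = {(f, g). f \<in> carrier P \<and> g \<in> carrier P \<and>
                        (map_ker X f, f ` X) = (map_ker X g, g ` X)}"
  by (auto simp: green_H_def green_R_P green_L_P)

lemma compose_in_P:
  assumes f: "f \<in> carrier P" and "inj_on \<beta> (f ` X)" "\<beta> ` f ` X \<subseteq> X" "inj_on a (\<beta> ` f ` X)"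
  shows "compose X \<beta> f \<in> carrier P" and "map_ker X (compose X \<beta> f) = map_ker X f"
    and "compose X \<beta> f ` X = \<beta> ` f ` X"
proof -
  have im: "compose X \<beta> f ` Y = \<beta> ` f ` Y" if "Y \<subseteq> X" for Y
    using that by (simp add: image_image compose_def subset_iff cong: image_cong)
  show "compose X \<beta> f ` X = \<beta> ` f ` X" by (simp add: im)
  show "map_ker X (compose X \<beta> f) = map_ker X f"
    using assms(2) by (auto simp: map_ker_def compose_def inj_on_def)
  show "compose X \<beta> f \<in> carrier P"
    using P_D(2)[OF f] assms(3,4) A_sub by (intro P_I) (simp_all add: im)
qed

text \<open>Kernels and images of the regular maps of a given rank can be prescribed independently of each
other. This makes each D-class a full rectangle of H-classes.\<close>
lemma ex_ker_im_P:
  assumes f: "f \<in> carrier P" and Y: "Y \<subseteq> X" "inj_on a Y" "card Y = map_rank X f"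
  shows "\<exists>h\<in>carrier P. map_ker X h = map_ker X f \<and> h ` X = Y"
proof -
  have "finite (f ` X)" "finite Y" using fin Y(1) finite_subset by auto
  then obtain \<beta> where "bij_betw \<beta> (f ` X) Y"
    using Y(3) finite_same_card_bij unfolding map_rank_def by metis
  then show ?thesis using compose_in_P[OF f, of \<beta>] Y by (auto simp: bij_betw_def)
qed

lemma green_D_P:
  "green_D P = {(f, g). f \<in> carrier P \<and> g \<in> carrier P \<and> map_rank X f = map_rank X g}"
    (is "_ = ?E")
proof
  have step: "green_R P \<union> green_L P \<subseteq> ?E"
    by (auto simp: green_R_P green_L_P map_rank_def dest: map_ker_eq_rank[unfolded map_rank_def])
  have "trans ?E" by (auto simp: trans_def)
  then show "green_D P \<subseteq> ?E" unfolding green_D_def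
    using step trancl_id[of ?E] trancl_mono[OF _ step] by blast
next
  show "?E \<subseteq> green_D P"
  proof clarify
    fix f g assume fg: "f \<in> carrier P" "g \<in> carrier P" "map_rank X f = map_rank X g"
    then obtain h where "h \<in> carrier P" "map_ker X h = map_ker X f" "h ` X = g ` X"
      using ex_ker_im_P[of f "g ` X"] P_D(3,5)[OF fg(2)] by (auto simp: map_rank_def)
    then have "(f, h) \<in> green_R P" "(h, g) \<in> green_L P" using fg by (simp_all add: green_R_P green_L_P)
    then show "(f, g) \<in> green_D P" unfolding green_D_def
      by (intro trancl_into_trancl[OF r_into_trancl[of f h]]) simp_all
  qed
qed

end

section \<open>The hat relations\<close>

lemma full_trans_eq_reg_variant:
  assumes "finite Y"
  shows "full_trans Y = reg_variant Y (\<lambda>x. x)"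
proof -
  interpret T: idempotent_map Y "\<lambda>x. x" by unfold_locales (use assms in auto)
  have "carrier (reg_variant Y (\<lambda>x. x)) = Y \<rightarrow>\<^sub>E Y" using T.carrier_P by auto
  moreover have "mult (reg_variant Y (\<lambda>x. x)) = (\<lambda>f g. compose Y g f)"
    by (auto simp: fun_eq_iff T.mult_P compose_def)
  moreover have "reg_variant Y (\<lambda>x. x) =
      semigroup_of (carrier (reg_variant Y (\<lambda>x. x))) (mult (reg_variant Y (\<lambda>x. x)))"
    by (simp add: reg_variant_def restrict_to_def)
  ultimately show ?thesis by (simp add: full_trans_def)
qed

context idempotent_map
begin

lemma idempotent_map_A: "idempotent_map A (\<lambda>x. x)"
  by unfold_locales (use fin in auto)

lemma full_trans_A: "full_trans A = reg_variant A (\<lambda>x. x)"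
  using fin by (simp add: full_trans_eq_reg_variant)

lemma phi_apply: "x \<in> A \<Longrightarrow> phi X a f x = a (f x)"
  using A_sub by (auto simp: phi_def full_trans_def compose_def)

lemma image_phi:
  assumes "f \<in> carrier P" shows "phi X a f ` A = a ` f ` X"
proof -
  have "phi X a f ` A = a ` f ` A" by (simp add: image_image phi_apply cong: image_cong)
  then show ?thesis using P_D(2)[OF assms] by simp
qed

lemma map_ker_phi:
  assumes "f \<in> carrier P" shows "map_ker A (phi X a f) = map_ker A f"
proof -
  have "a (f x) = a (f y) \<longleftrightarrow> f x = f y" if "x \<in> A" "y \<in> A" for x y
    using that A_sub by (intro inj_on_eq_iff[OF P_D(3)[OF assms]]) auto
  then show ?thesis unfolding map_ker_eq_iff using phi_apply by simp
qed

lemma phi_closed: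
  assumes "f \<in> carrier P" shows "phi X a f \<in> carrier (full_trans A)"
proof -
  have "phi X a f \<in> extensional A" by (simp add: phi_def)
  moreover have "phi X a f ` A \<subseteq> A" unfolding image_phi[OF assms] using P_D(6)[OF assms] by auto
  ultimately show ?thesis by (auto simp: full_trans_def PiE_def)
qed

lemma hat_R:
  "hat X a green_R = {(f, g). f \<in> carrier P \<and> g \<in> carrier P \<and> map_ker A f = map_ker A g}"
  unfolding hat_def full_trans_A idempotent_map.green_R_P[OF idempotent_map_A]
  using phi_closed by (simp add: full_trans_A map_ker_phi cong: conj_cong)

lemma hat_L:
  "hat X a green_L = {(f, g). f \<in> carrier P \<and> g \<in> carrier P \<and> a ` f ` X = a ` g ` X}"
  unfolding hat_def full_trans_A idempotent_map.green_L_P[OF idempotent_map_A]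
  using phi_closed by (simp add: full_trans_A image_phi cong: conj_cong)

lemma hat_H: "hat X a green_H = hat X a green_R \<inter> hat X a green_L"
  by (auto simp: hat_def green_H_def)

lemma card_image_a:
  assumes "f \<in> carrier P" shows "card (a ` f ` X) = map_rank X f"
  using P_D(3)[OF assms] by (simp add: map_rank_def card_image)

lemma hat_D: "hat X a green_D = green_D P"
  unfolding green_D_P hat_def full_trans_A idempotent_map.green_D_P[OF idempotent_map_A]
  using phi_closed
  by (simp add: full_trans_A map_rank_def[of A] image_phi card_image_a cong: conj_cong)

lemma map_rank_eq_card: "card (f ` X) = map_rank X f"
  by (simp add: map_rank_def)

lemma rank_hat_R:
  assumes "(f, g) \<in> hat X a green_R" shows "map_rank X g = map_rank X f"
  using assms map_ker_eq_rank[of A f g] P_D(2)[of f] P_D(2)[of g] by (simp add: hat_R map_rank_def)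

lemma rank_hat_L:
  assumes "(f, g) \<in> hat X a green_L" shows "map_rank X g = map_rank X f"
  using assms card_image_a[of f] card_image_a[of g] by (simp add: hat_L)

section \<open>Numbers of kernels and images\<close>

lemma images_hat_L:
  assumes f: "f \<in> carrier P"
  shows "(\<lambda>g. g ` X) ` (hat X a green_L `` {f}) = {Y. Y \<subseteq> X \<and> inj_on a Y \<and> a ` Y = a ` f ` X}"
proof (intro subset_antisym subsetI)
  fix Y assume "Y \<in> (\<lambda>g. g ` X) ` (hat X a green_L `` {f})"
  then obtain g where "g \<in> carrier P" "a ` g ` X = a ` f ` X" "Y = g ` X" by (auto simp: hat_L)
  then show "Y \<in> {Y. Y \<subseteq> X \<and> inj_on a Y \<and> a ` Y = a ` f ` X}" using P_D(3,5) by simp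
next
  fix Y assume "Y \<in> {Y. Y \<subseteq> X \<and> inj_on a Y \<and> a ` Y = a ` f ` X}"
  then have Y: "Y \<subseteq> X" "inj_on a Y" "a ` Y = a ` f ` X" by simp_all
  then have "card Y = map_rank X f" using card_image_a[OF f] card_image[of a Y] by simp
  then obtain h where h: "h \<in> carrier P" "h ` X = Y" using ex_ker_im_P[OF f Y(1,2)] by blast
  then have "h \<in> hat X a green_L `` {f}" using f Y(3) by (simp add: hat_L)
  then show "Y \<in> (\<lambda>g. g ` X) ` (hat X a green_L `` {f})" using h(2) by blast
qed

lemma images_rank:
  assumes f: "f \<in> carrier P"
  shows "(\<lambda>g. g ` X) ` {g \<in> carrier P. map_rank X g = map_rank X f}
       = {Y. Y \<subseteq> X \<and> inj_on a Y \<and> card Y = map_rank X f}"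
proof (intro subset_antisym subsetI)
  fix Y assume "Y \<in> (\<lambda>g. g ` X) ` {g \<in> carrier P. map_rank X g = map_rank X f}"
  then show "Y \<in> {Y. Y \<subseteq> X \<and> inj_on a Y \<and> card Y = map_rank X f}"
    using P_D(3,5) by (auto simp: map_rank_eq_card)
next
  fix Y assume "Y \<in> {Y. Y \<subseteq> X \<and> inj_on a Y \<and> card Y = map_rank X f}"
  then have Y: "Y \<subseteq> X" "inj_on a Y" "card Y = map_rank X f" by simp_all
  then obtain h where h: "h \<in> carrier P" "h ` X = Y" using ex_ker_im_P[OF f] by blast
  then show "Y \<in> (\<lambda>g. g ` X) ` {g \<in> carrier P. map_rank X g = map_rank X f}"
    using Y(3) by (auto simp: map_rank_def)
qed

lemma extension_in_P:
  assumes f: "f \<in> carrier P" and "g \<in> X \<rightarrow>\<^sub>E f ` X" and "g ` A = f ` X"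
  shows "g \<in> carrier P" and "g ` X = f ` X"
proof -
  have "g ` A \<subseteq> g ` X" using A_sub by blast
  then show im: "g ` X = f ` X" using assms(2,3) by auto
  then show "g \<in> carrier P" using assms P_D(3,5)[OF f] by (intro P_I) (auto simp: PiE_def)
qed

text \<open>Every kernel that occurs in the hat R-class of \<open>f\<close> is the kernel of exactly one map that agrees
with \<open>f\<close> on \<open>A\<close> and has the same image; such a map is free on \<open>X - A\<close>.\<close>
lemma card_kernels_hat_R:
  assumes f: "f \<in> carrier P"
  shows "card (map_ker X ` (hat X a green_R `` {f})) = map_rank X f ^ card (X - A)"
proof -
  let ?T = "{g \<in> X \<rightarrow>\<^sub>E f ` X. restrict g A \<in> {restrict f A}}"
  have T: "g \<in> carrier P" "g ` X = f ` X" "\<And>x. x \<in> A \<Longrightarrow> g x = f x" if "g \<in> ?T" for g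
  proof -
    show eq: "g x = f x" if "x \<in> A" for x using \<open>g \<in> ?T\<close> that by (auto dest: fun_cong[of _ _ x])
    have "g ` A = f ` X" using eq P_D(2)[OF f] by (simp cong: image_cong)
    then show "g \<in> carrier P" "g ` X = f ` X" using extension_in_P[OF f, of g] that by auto
  qed
  have "inj_on (map_ker X) ?T"
  proof (rule inj_onI)
    fix g h assume g: "g \<in> ?T" and h: "h \<in> ?T" and ker: "map_ker X g = map_ker X h"
    show "g = h"
    proof (rule P_ext[OF T(1)[OF g] T(1)[OF h]])
      fix x assume x: "x \<in> X"
      then obtain y where y: "y \<in> A" "g x = g y" using P_D(2)[OF T(1)[OF g]] by (metis imageE imageI)
      then have "h x = h y" using ker x A_sub unfolding map_ker_eq_iff by blast
      then show "g x = h x" using y T(3)[OF g] T(3)[OF h] by simp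
    qed
  qed
  moreover have "map_ker X ` ?T = map_ker X ` (hat X a green_R `` {f})"
  proof (intro subset_antisym image_subsetI)
    fix g assume "g \<in> ?T"
    then have "g \<in> carrier P" "map_ker A f = map_ker A g" using T[OF \<open>g \<in> ?T\<close>] by (simp_all add: map_ker_eq_iff)
    then show "map_ker X g \<in> map_ker X ` (hat X a green_R `` {f})" using f by (auto simp: hat_R)
  next
    fix g assume "g \<in> hat X a green_R `` {f}"
    then have g: "g \<in> carrier P" and ker: "map_ker A g = map_ker A f" using f by (auto simp: hat_R)
    \<comment> \<open>\<open>\<beta>\<close> relabels the values of \<open>g\<close> so that they agree with those of \<open>f\<close> on \<open>A\<close>\<close>
    obtain \<beta> where \<beta>: "bij_betw \<beta> (g ` A) (f ` A)" "\<And>x. x \<in> A \<Longrightarrow> \<beta> (g x) = f x"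
      using map_ker_eq_factor[OF ker] by blast
    let ?h = "compose X \<beta> g"
    have \<beta>': "inj_on \<beta> (g ` X)" "\<beta> ` g ` X = f ` X"
      using \<beta>(1) P_D(2)[OF f] P_D(2)[OF g] by (auto simp: bij_betw_def)
    have h: "map_ker X ?h = map_ker X g" "?h ` X = f ` X"
      using compose_in_P[OF g \<beta>'(1)] \<beta>'(2) P_D(3,5)[OF f] by simp_all
    have "restrict ?h A = restrict f A"
      using \<beta>(2) A_sub by (auto simp: compose_def restrict_def fun_eq_iff)
    moreover have "?h \<in> X \<rightarrow>\<^sub>E f ` X" using h(2) by (auto simp: PiE_def compose_def)
    ultimately have "?h \<in> ?T" by simp
    then show "map_ker X g \<in> map_ker X ` ?T" by (rule image_eqI[rotated]) (simp only: h(1))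
  qed
  moreover have "card ?T = card {restrict f A} * card (f ` X) ^ card (X - A)"
    using fin A_sub P_D(6)[OF f] by (intro card_extensions) auto
  ultimately show ?thesis using card_image[of "map_ker X" ?T] by (simp add: map_rank_def)
qed

text \<open>The maps with the same kernel and image as \<open>f\<close> are the composites of \<open>f\<close> with a permutation of
its image.\<close>
lemma card_ker_im_class:
  assumes f: "f \<in> carrier P"
  shows "card {g \<in> carrier P. map_ker X g = map_ker X f \<and> g ` X = f ` X} = fact (map_rank X f)"
proof -
  let ?H = "{g \<in> carrier P. map_ker X g = map_ker X f \<and> g ` X = f ` X}"
  have "bij_betw (\<lambda>p. compose X p f) {p. p permutes (f ` X)} ?H"
    unfolding bij_betw_def
  proof
    show "inj_on (\<lambda>p. compose X p f) {p. p permutes (f ` X)}"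
    proof (rule inj_onI)
      fix p q assume pq: "p \<in> {p. p permutes (f ` X)}" "q \<in> {p. p permutes (f ` X)}"
        and eq: "compose X p f = compose X q f"
      show "p = q"
      proof
        fix y
        show "p y = q y"
        proof (cases "y \<in> f ` X")
          case True
          then obtain x where "x \<in> X" "y = f x" by blast
          then show ?thesis using fun_cong[OF eq, of x] by (simp add: compose_def)
        next
          case False
          then show ?thesis using pq permutes_not_in[of p "f ` X" y] permutes_not_in[of q "f ` X" y] by simp
        qed
      qed
    qed
    show "(\<lambda>p. compose X p f) ` {p. p permutes (f ` X)} = ?H"
    proof (intro subset_antisym image_subsetI subsetI)
      fix p assume "p \<in> {p. p permutes (f ` X)}"
      then have "inj_on p (f ` X)" "p ` f ` X = f ` X"
        by (auto simp: permutes_inj_on permutes_image)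
      then show "compose X p f \<in> ?H"
        using compose_in_P[OF f, of p] P_D(3,5)[OF f] by simp
    next
      fix g assume "g \<in> ?H"
      then have g: "g \<in> carrier P" and ker: "map_ker X f = map_ker X g" and im: "g ` X = f ` X" by simp_all
      obtain \<beta> where \<beta>: "bij_betw \<beta> (f ` X) (g ` X)" "\<And>x. x \<in> X \<Longrightarrow> \<beta> (f x) = g x"
        using map_ker_eq_factor[OF ker] by blast
      let ?p = "\<lambda>y. if y \<in> f ` X then \<beta> y else y"
      have "bij_betw ?p (f ` X) (f ` X)" using \<beta>(1) unfolding im by (simp cong: bij_betw_cong)
      then have "?p permutes (f ` X)" by (rule bij_imp_permutes) simp
      moreover have "g = compose X ?p f"
        by (rule extensionalityI[OF P_D(4)[OF g]]) (simp_all add: \<beta>(2) compose_def)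
      ultimately show "g \<in> (\<lambda>p. compose X p f) ` {p. p permutes (f ` X)}" by blast
    qed
  qed
  then show ?thesis
    using fin by (simp add: bij_betw_same_card[symmetric] card_permutations map_rank_def)
qed

text \<open>All kernels of rank \<open>m\<close> occur among the maps with the same image as \<open>f\<close>. There are
\<open>m! * S(r, m) * m ^ (n - r)\<close> such maps, namely a surjection from \<open>A\<close> extended arbitrarily to \<open>X\<close>, and each kernel
belongs to \<open>m!\<close> of them.\<close>
lemma card_kernels_rank:
  assumes f: "f \<in> carrier P"
  defines "m \<equiv> map_rank X f"
  shows "card (map_ker X ` {g \<in> carrier P. map_rank X g = m}) = m ^ card (X - A) * Stirling (card A) m"
proof -
  let ?Y = "f ` X"
  let ?L = "{g \<in> carrier P. g ` X = ?Y}"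
  have "?L = {g \<in> X \<rightarrow>\<^sub>E ?Y. restrict g A \<in> {p \<in> A \<rightarrow>\<^sub>E ?Y. p ` A = ?Y}}" (is "_ = ?R")
  proof (intro subset_antisym subsetI)
    fix g assume "g \<in> ?L"
    then have g: "g \<in> carrier P" "g ` X = ?Y" by simp_all
    have "g \<in> X \<rightarrow>\<^sub>E ?Y" using P_D(4)[OF g(1)] g(2) by (auto simp: PiE_def)
    moreover have "restrict g A ` A = ?Y" using P_D(2)[OF g(1)] g(2) by simp
    ultimately show "g \<in> ?R" using A_sub by auto
  next
    fix g assume "g \<in> ?R"
    then have "g \<in> X \<rightarrow>\<^sub>E ?Y" "g ` A = ?Y" by simp_all
    then show "g \<in> ?L" using extension_in_P[OF f] by simp
  qed
  then have "card ?L = card {p \<in> A \<rightarrow>\<^sub>E ?Y. p ` A = ?Y} * card ?Y ^ card (X - A)"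
    using card_extensions[of X A "{p \<in> A \<rightarrow>\<^sub>E ?Y. p ` A = ?Y}" ?Y] fin A_sub by auto
  also have "\<dots> = m ^ card (X - A) * Stirling (card A) m * fact m"
    using card_surjections[of A ?Y] fin by (simp add: m_def map_rank_def)
  finally have "card ?L = m ^ card (X - A) * Stirling (card A) m * fact m" .
  moreover have "card ?L = card (map_ker X ` ?L) * fact m"
  proof (rule card_eq_card_image_mult)
    show "finite ?L" using finite_P by simp
    fix g assume "g \<in> ?L"
    then have "g \<in> carrier P" "g ` X = ?Y" by simp_all
    moreover have "{h \<in> ?L. map_ker X h = map_ker X g} = {h \<in> carrier P. map_ker X h = map_ker X g \<and> h ` X = ?Y}"
      by auto
    ultimately show "card {h \<in> ?L. map_ker X h = map_ker X g} = fact m"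
      using card_ker_im_class[of g] by (simp add: m_def map_rank_def)
  qed
  moreover have "map_ker X ` {g \<in> carrier P. map_rank X g = m} = map_ker X ` ?L"
  proof (intro subset_antisym image_subsetI)
    fix g assume "g \<in> {g \<in> carrier P. map_rank X g = m}"
    then obtain h where "h \<in> carrier P" "map_ker X h = map_ker X g" "h ` X = ?Y"
      using ex_ker_im_P[of g ?Y] P_D(3,5)[OF f] by (auto simp: m_def map_rank_def)
    then show "map_ker X g \<in> map_ker X ` ?L" by (metis (mono_tags, lifting) imageI mem_Collect_eq)
  qed (auto simp: m_def map_rank_def)
  ultimately show ?thesis by simp
qed

text \<open>If \<open>S\<close> is a union of R-classes and \<open>S'\<close> a union of L-classes within a single D-class, then the
H-classes in \<open>S \<inter> S'\<close> correspond to the pairs of an R-class in \<open>S\<close> and an L-class in \<open>S'\<close>.\<close>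
lemma image_ker_im_eq_Times:
  assumes rank: "\<And>f. f \<in> S \<Longrightarrow> f \<in> carrier P \<and> map_rank X f = m" "\<And>g. g \<in> S' \<Longrightarrow> g \<in> carrier P \<and> map_rank X g = m"
    and R: "\<And>f h. f \<in> S \<Longrightarrow> h \<in> carrier P \<Longrightarrow> map_ker X h = map_ker X f \<Longrightarrow> h \<in> S"
    and L: "\<And>g h. g \<in> S' \<Longrightarrow> h \<in> carrier P \<Longrightarrow> h ` X = g ` X \<Longrightarrow> h \<in> S'"
  shows "(\<lambda>h. (map_ker X h, h ` X)) ` (S \<inter> S') = (map_ker X ` S) \<times> ((\<lambda>g. g ` X) ` S')"
proof (intro subset_antisym subsetI)
  fix u assume "u \<in> (map_ker X ` S) \<times> ((\<lambda>g. g ` X) ` S')"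
  then obtain f g where u: "f \<in> S" "g \<in> S'" "u = (map_ker X f, g ` X)" by blast
  then obtain h where h: "h \<in> carrier P" "map_ker X h = map_ker X f" "h ` X = g ` X"
    using ex_ker_im_P[of f "g ` X"] rank P_D(3,5)[of g] map_rank_eq_card by metis
  then have "h \<in> S \<inter> S'" using R[OF u(1) h(1,2)] L[OF u(2) h(1,3)] by simp
  then show "u \<in> (\<lambda>h. (map_ker X h, h ` X)) ` (S \<inter> S')" using h u by (intro image_eqI[of _ _ h]) simp_all
qed auto

lemma map_ker_A_eqI:
  assumes "map_ker X f = map_ker X g" shows "map_ker A f = map_ker A g"
  using assms A_sub unfolding map_ker_eq_iff by blast

section \<open>Numbers of Green classes\<close>

lemma hat_R_classes:
  assumes f: "f \<in> carrier P"
  shows "is_union_of (hat X a green_R `` {f}) (map_rank X f ^ card (X - A)) (carrier P // green_R P)"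
  unfolding card_kernels_hat_R[OF f, symmetric]
  by (rule is_union_of_invariant[OF green_R_P])
     (auto simp: hat_R f finite_P dest: map_ker_A_eqI intro: finite_subset[OF _ finite_P])

lemma hat_L_classes:
  assumes f: "f \<in> carrier P"
  shows "is_union_of (hat X a green_L `` {f}) (\<Prod>b\<in>a ` f ` X. card {x \<in> X. a x = b})
           (carrier P // green_L P)"
proof -
  have "card ((\<lambda>g. g ` X) ` (hat X a green_L `` {f})) = (\<Prod>b\<in>a ` f ` X. card {x \<in> X. a x = b})"
    unfolding images_hat_L[OF f] using fin by (simp add: card_transversals)
  moreover have "is_union_of (hat X a green_L `` {f}) (card ((\<lambda>g. g ` X) ` (hat X a green_L `` {f})))
      (carrier P // green_L P)"
    by (rule is_union_of_invariant[OF green_L_P])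
       (auto simp: hat_L f intro: finite_subset[OF _ finite_P])
  ultimately show ?thesis by simp
qed

lemma hat_H_classes:
  assumes f: "f \<in> carrier P"
  shows "is_union_of (hat X a green_H `` {f})
           (map_rank X f ^ card (X - A) * (\<Prod>b\<in>a ` f ` X. card {x \<in> X. a x = b}))
           (carrier P // green_H P)"
proof -
  let ?R = "hat X a green_R `` {f}" and ?L = "hat X a green_L `` {f}"
  have H: "hat X a green_H `` {f} = ?R \<inter> ?L" by (auto simp: hat_H)
  have "(\<lambda>h. (map_ker X h, h ` X)) ` (?R \<inter> ?L) = (map_ker X ` ?R) \<times> ((\<lambda>g. g ` X) ` ?L)"
  proof (rule image_ker_im_eq_Times[where m = "map_rank X f"])
    show "g \<in> carrier P \<and> map_rank X g = map_rank X f" if "g \<in> ?R" for g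
      using that rank_hat_R[of f g] by (auto simp: hat_R)
    show "g \<in> carrier P \<and> map_rank X g = map_rank X f" if "g \<in> ?L" for g
      using that rank_hat_L[of f g] by (auto simp: hat_L)
    show "h \<in> ?R" if "g \<in> ?R" "h \<in> carrier P" "map_ker X h = map_ker X g" for g h
      using that map_ker_A_eqI[OF that(3)] by (simp add: hat_R)
    show "h \<in> ?L" if "g \<in> ?L" "h \<in> carrier P" "h ` X = g ` X" for g h
      using that by (simp add: hat_L)
  qed
  then have "card ((\<lambda>h. (map_ker X h, h ` X)) ` (hat X a green_H `` {f})) =
      map_rank X f ^ card (X - A) * (\<Prod>b\<in>a ` f ` X. card {x \<in> X. a x = b})"
    using fin by (simp add: H card_cartesian_product card_kernels_hat_R[OF f] images_hat_L[OF f] card_transversals)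
  moreover have "is_union_of (hat X a green_H `` {f})
      (card ((\<lambda>h. (map_ker X h, h ` X)) ` (hat X a green_H `` {f}))) (carrier P // green_H P)"
  proof (rule is_union_of_invariant[OF green_H_P])
    show sub: "hat X a green_H `` {f} \<subseteq> carrier P" by (auto simp: hat_def)
    then show "finite (hat X a green_H `` {f})" using finite_P finite_subset by blast
    fix g h assume "g \<in> hat X a green_H `` {f}" "h \<in> carrier P" "(map_ker X g, g ` X) = (map_ker X h, h ` X)"
    then show "h \<in> hat X a green_H `` {f}"
      using map_ker_A_eqI[of g h] by (simp add: hat_H hat_R hat_L)
  qed
  ultimately show ?thesis by simp
qed

lemma green_D_class:
  assumes f: "f \<in> carrier P"
  shows "green_D P `` {f} = {g \<in> carrier P. map_rank X g = map_rank X f}"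
  using f by (auto simp: green_D_P)

lemma D_R_classes:
  assumes f: "f \<in> carrier P"
  shows "is_union_of (green_D P `` {f}) (map_rank X f ^ card (X - A) * Stirling (card A) (map_rank X f))
           (carrier P // green_R P)"
  unfolding green_D_class[OF f] card_kernels_rank[OF f, symmetric]
  by (rule is_union_of_invariant[OF green_R_P]) (auto simp: finite_P dest: map_ker_eq_rank)

lemma D_L_classes:
  assumes f: "f \<in> carrier P"
  shows "is_union_of (green_D P `` {f})
           (\<Sum>B | B \<subseteq> A \<and> card B = map_rank X f. \<Prod>b\<in>B. card {x \<in> X. a x = b}) (carrier P // green_L P)"
  unfolding green_D_class[OF f] card_partial_transversals[OF fin, symmetric] images_rank[OF f, symmetric]
  by (rule is_union_of_invariant[OF green_L_P]) (auto simp: finite_P map_rank_def)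

lemma D_H_classes:
  assumes f: "f \<in> carrier P"
  shows "is_union_of (green_D P `` {f})
           (map_rank X f ^ card (X - A) * Stirling (card A) (map_rank X f) *
            (\<Sum>B | B \<subseteq> A \<and> card B = map_rank X f. \<Prod>b\<in>B. card {x \<in> X. a x = b})) (carrier P // green_H P)"
proof -
  let ?D = "{g \<in> carrier P. map_rank X g = map_rank X f}"
  have "(\<lambda>h. (map_ker X h, h ` X)) ` (?D \<inter> ?D) = (map_ker X ` ?D) \<times> ((\<lambda>g. g ` X) ` ?D)"
    by (rule image_ker_im_eq_Times[where m = "map_rank X f"]) (auto dest: map_ker_eq_rank simp: map_rank_def)
  then have "card ((\<lambda>h. (map_ker X h, h ` X)) ` ?D) = map_rank X f ^ card (X - A) * Stirling (card A) (map_rank X f) *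
            (\<Sum>B | B \<subseteq> A \<and> card B = map_rank X f. \<Prod>b\<in>B. card {x \<in> X. a x = b})"
    by (simp add: card_cartesian_product card_kernels_rank[OF f] images_rank[OF f] card_partial_transversals[OF fin])
  moreover have "is_union_of ?D (card ((\<lambda>h. (map_ker X h, h ` X)) ` ?D)) (carrier P // green_H P)"
    by (rule is_union_of_invariant[OF green_H_P]) (auto simp: finite_P map_rank_def)
  ultimately show ?thesis by (simp add: green_D_class[OF f])
qed

lemma inj_on_phi_H_class:
  assumes "K \<in> carrier P // green_H P" shows "inj_on (phi X a) K"
proof (rule inj_onI)
  fix g h assume gh: "g \<in> K" "h \<in> K" and eq: "phi X a g = phi X a h"
  then have g: "g \<in> carrier P" and h: "h \<in> carrier P" and ker: "map_ker X g = map_ker X h" and im: "g ` X = h ` X"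
    using assms by (auto simp: quotient_def green_H_P)
  have A: "g y = h y" if "y \<in> A" for y
  proof -
    have "a (g y) = a (h y)" using phi_apply[OF that] eq by metis
    moreover have "g y \<in> g ` X" "h y \<in> g ` X" using that A_sub im by blast+
    ultimately show ?thesis using P_D(3)[OF g] by (meson inj_on_eq_iff)
  qed
  show "g = h"
  proof (rule P_ext[OF g h])
    fix x assume x: "x \<in> X"
    then obtain y where y: "y \<in> A" "g x = g y" using P_D(2)[OF g] by (metis imageE imageI)
    then have "h x = h y" using ker x A_sub unfolding map_ker_eq_iff by blast
    then show "g x = h x" using y A by simp
  qed
qed

end

section \<open>Group H-classes and rectangular groups\<close>

text \<open>If the H-class of \<open>f\<close> is a group, it contains the square of \<open>f\<close>, whose image \<open>f ` a ` f ` X\<close> must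
then be all of \<open>f ` X\<close>.\<close>
lemma (in idempotent_map) inj_on_if_H_class_group:
  assumes f: "f \<in> carrier P" and grp: "group (restrict_to P (green_H P `` {f}))"
  shows "inj_on f (a ` f ` X)"
proof -
  interpret group "restrict_to P (green_H P `` {f})" by (rule grp)
  have "f \<in> green_H P `` {f}" using f by (simp add: green_H_P)
  then have "f \<otimes>\<^bsub>P\<^esub> f \<in> green_H P `` {f}" using m_closed[of f f] by (simp add: restrict_to_def)
  then have "f ` a ` f ` X = f ` X" by (simp add: green_H_P image_mult_P)
  then have "card (f ` a ` f ` X) = card (a ` f ` X)"
    using card_image_a[OF f] by (simp add: map_rank_def)
  then show ?thesis using fin by (intro eq_card_imp_inj_on) simp_all
qed

text \<open>A regular map \<open>f\<close> of rank \<open>m\<close> that is injective on \<open>B = a ` f ` X\<close>, the image of its companion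
\<open>phi X a f\<close> on \<open>A\<close>. Then \<open>a \<circ> f\<close> permutes \<open>B\<close>. The labelling \<open>b\<close> of \<open>B\<close> serves to identify the
permutations of \<open>B\<close> with the elements of \<open>sym_group m\<close>.\<close>
locale group_hat_class = idempotent_map +
  fixes f :: "'a \<Rightarrow> 'a" and m :: nat and b :: "nat \<Rightarrow> 'a"
  assumes f: "f \<in> carrier P" and inj: "inj_on f (a ` f ` X)"
    and b: "bij_betw b {1..m} (a ` f ` X)"
begin

definition B :: "'a set" where "B = a ` f ` X"

text \<open>The index set \<open>{1..m}\<close> is only used as a whole; it is kept from being taken apart.\<close>
declare atLeastAtMost_iff [simp del] One_nat_def [simp del]

lemma bij_b: "bij_betw b {1..m} B" using b by (simp add: B_def)

lemma finite_B: "finite B" using fin by (simp add: B_def)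

lemma af_in_B: "x \<in> X \<Longrightarrow> a (f x) \<in> B" by (simp add: B_def)

text \<open>The retractions of \<open>X\<close> onto \<open>B\<close> that have on \<open>A\<close> the same kernel as \<open>f\<close>. On \<open>A\<close> such a map is
determined by \<open>f\<close>: it sends \<open>x\<close> to the only point of \<open>B\<close> with the same value under \<open>f\<close>.\<close>
definition projections :: "('a \<Rightarrow> 'a) set" where
  "projections = {w \<in> X \<rightarrow>\<^sub>E B. restrict w A \<in> {\<lambda>x\<in>A. inv_into B (a \<circ> f) (a (f x))}}"

text \<open>The sections of \<open>a\<close> over \<open>B\<close>; their images are the possible images in the hat H-class of \<open>f\<close>.\<close>
definition sections :: "('a \<Rightarrow> 'a) set" where
  "sections = (\<Pi>\<^sub>E c\<in>B. {x \<in> X. a x = c})"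

text \<open>The permutation of \<open>B\<close> labelled by \<open>\<sigma>\<close>. The inverse of \<open>\<sigma>\<close> occurs because products in \<open>P\<close>
apply the left factor first, while products in \<open>sym_group m\<close> apply the right factor first.\<close>
definition perm_on_B :: "(nat \<Rightarrow> nat) \<Rightarrow> 'a \<Rightarrow> 'a" where
  "perm_on_B \<sigma> c = b (inv' \<sigma> (inv_into {1..m} b c))"

text \<open>Coordinates on the hat H-class of \<open>f\<close>: a projection, a section, and a permutation in between.\<close>
definition triple :: "('a \<Rightarrow> 'a) \<Rightarrow> ('a \<Rightarrow> 'a) \<Rightarrow> (nat \<Rightarrow> nat) \<Rightarrow> 'a \<Rightarrow> 'a" where
  "triple w s \<sigma> = (\<lambda>x\<in>X. s (perm_on_B \<sigma> (w x)))"

lemma B_sub: "B \<subseteq> A" unfolding B_def using P_D(5)[OF f] by (rule image_mono)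

lemma B_sub_X: "B \<subseteq> X" using B_sub A_sub by (rule subset_trans)

lemma m_eq: "m = map_rank X f"
  using bij_betw_same_card[OF b] card_image_a[OF f] by simp

lemma inj_af: "inj_on (a \<circ> f) B"
  using inj inj_on_subset[OF P_D(3)[OF f] image_mono[OF B_sub_X]]
  unfolding B_def by (rule comp_inj_on)

lemma image_af: "(a \<circ> f) ` B = B"
proof (rule endo_inj_surj[OF _ _ inj_af])
  show "finite B" by (rule finite_B)
  show "(a \<circ> f) ` B \<subseteq> B" using B_sub_X af_in_B by auto
qed

lemma retract:
  assumes "x \<in> X"
  shows "inv_into B (a \<circ> f) (a (f x)) \<in> B" and "a (f (inv_into B (a \<circ> f) (a (f x)))) = a (f x)"
proof -
  have im: "a (f x) \<in> (a \<circ> f) ` B" unfolding image_af using assms by (rule af_in_B)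
  show "inv_into B (a \<circ> f) (a (f x)) \<in> B" using im by (rule inv_into_into)
  show "a (f (inv_into B (a \<circ> f) (a (f x)))) = a (f x)" using f_inv_into_f[OF im] by simp
qed

lemma af_eq_iff:
  assumes "x \<in> X" "y \<in> X" shows "a (f x) = a (f y) \<longleftrightarrow> f x = f y"
  using assms by (intro inj_on_eq_iff[OF P_D(3)[OF f]]) simp_all

lemma projections_iff:
  "w \<in> projections \<longleftrightarrow> w \<in> X \<rightarrow>\<^sub>E B \<and> (\<forall>x\<in>A. w x = inv_into B (a \<circ> f) (a (f x)))"
  unfolding projections_def by (auto simp: restrict_def fun_eq_iff)

lemma projection:
  assumes "w \<in> projections"
  shows "\<And>x. x \<in> X \<Longrightarrow> w x \<in> B" and "\<And>c. c \<in> B \<Longrightarrow> w c = c"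
    and "\<And>x y. x \<in> A \<Longrightarrow> y \<in> A \<Longrightarrow> w x = w y \<longleftrightarrow> f x = f y"
proof -
  have w: "w x = inv_into B (a \<circ> f) (a (f x))" if "x \<in> A" for x
    using assms that unfolding projections_iff by blast
  show "w x \<in> B" if "x \<in> X" for x using assms that unfolding projections_iff by blast
  show "w c = c" if "c \<in> B" for c
    using w[of c] inv_into_f_f[OF inj_af that] subsetD[OF B_sub that] by simp
  show "w x = w y \<longleftrightarrow> f x = f y" if "x \<in> A" "y \<in> A" for x y
  proof -
    have X: "x \<in> X" "y \<in> X" using that A_sub by auto
    then show ?thesis using w[OF that(1)] w[OF that(2)] retract(2) af_eq_iff[OF X] by metis
  qed
qed

lemma section_apply:
  assumes "s \<in> sections" "c \<in> B" shows "s c \<in> X" and "a (s c) = c"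
  using PiE_mem[OF assms[unfolded sections_def]] by simp_all

lemma card_projections: "card projections = m ^ card (X - A)"
proof -
  have "(\<lambda>x\<in>A. inv_into B (a \<circ> f) (a (f x))) \<in> A \<rightarrow>\<^sub>E B"
    using retract(1) maps by auto
  then have "card projections = card {\<lambda>x\<in>A. inv_into B (a \<circ> f) (a (f x))} * card B ^ card (X - A)"
    unfolding projections_def using fin A_sub by (intro card_extensions) auto
  then show ?thesis using bij_betw_same_card[OF bij_b] by simp
qed

lemma card_sections: "card sections = (\<Prod>c\<in>B. card {x \<in> X. a x = c})"
  unfolding sections_def using finite_B by (simp add: card_PiE)

lemma b_inv:
  assumes "c \<in> B" shows "inv_into {1..m} b c \<in> {1..m}" and "b (inv_into {1..m} b c) = c"
  using assms bij_b inv_into_into[of c b "{1..m}"] f_inv_into_f[of c b "{1..m}"]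
  by (simp_all add: bij_betw_def)

lemma inv_b: "i \<in> {1..m} \<Longrightarrow> inv_into {1..m} b (b i) = i"
  using bij_b by (rule bij_betw_inv_into_left)

lemma b_in: "i \<in> {1..m} \<Longrightarrow> b i \<in> B"
  using bij_b by (rule bij_betw_apply)

lemma perm_on_B:
  assumes "\<sigma> permutes {1..m}"
  shows "\<And>c. c \<in> B \<Longrightarrow> perm_on_B \<sigma> c \<in> B" and "inj_on (perm_on_B \<sigma>) B" and "perm_on_B \<sigma> ` B = B"
proof -
  have inv: "inv' \<sigma> permutes {1..m}" using assms by (rule permutes_inv)
  show in_B: "perm_on_B \<sigma> c \<in> B" if "c \<in> B" for c
    unfolding perm_on_B_def using b_inv(1)[OF that] permutes_in_image[OF inv] b_in by metis
  show inj: "inj_on (perm_on_B \<sigma>) B"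
  proof (rule inj_onI)
    fix c d assume c: "c \<in> B" and d: "d \<in> B" and "perm_on_B \<sigma> c = perm_on_B \<sigma> d"
    moreover have "inv' \<sigma> (inv_into {1..m} b c) \<in> {1..m}" "inv' \<sigma> (inv_into {1..m} b d) \<in> {1..m}"
      using b_inv(1) c d permutes_in_image[OF inv] by metis+
    ultimately have "inv' \<sigma> (inv_into {1..m} b c) = inv' \<sigma> (inv_into {1..m} b d)"
      unfolding perm_on_B_def using inv_b by metis
    then have "inv_into {1..m} b c = inv_into {1..m} b d"
      using permutes_inj[OF inv] by (simp add: inj_eq)
    then show "c = d" using b_inv(2) c d by metis
  qed
  show "perm_on_B \<sigma> ` B = B"
    using in_B finite_B by (intro endo_inj_surj[OF _ _ inj]) auto
qed

lemma perm_on_B_comp: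
  assumes "\<sigma> permutes {1..m}" "\<tau> permutes {1..m}" "c \<in> B"
  shows "perm_on_B (\<sigma> \<circ> \<tau>) c = perm_on_B \<tau> (perm_on_B \<sigma> c)"
proof -
  have "inv' \<sigma> (inv_into {1..m} b c) \<in> {1..m}"
    using b_inv(1)[OF assms(3)] permutes_in_image[OF permutes_inv[OF assms(1)]] by metis
  moreover have "inv' (\<sigma> \<circ> \<tau>) = inv' \<tau> \<circ> inv' \<sigma>"
    using assms(1,2) by (intro o_inv_distrib permutes_bij)
  ultimately show ?thesis by (simp add: perm_on_B_def inv_b)
qed

lemma perm_on_B_inject:
  assumes \<sigma>: "\<sigma> permutes {1..m}" and \<tau>: "\<tau> permutes {1..m}"
    and eq: "\<And>c. c \<in> B \<Longrightarrow> perm_on_B \<sigma> c = perm_on_B \<tau> c"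
  shows "\<sigma> = \<tau>"
proof -
  have "inv' \<sigma> i = inv' \<tau> i" for i
  proof (cases "i \<in> {1..m}")
    case True
    then have "b (inv' \<sigma> i) = b (inv' \<tau> i)"
      using eq[OF b_in[OF True]] inv_b[OF True] by (simp add: perm_on_B_def)
    moreover have "inv' \<sigma> i \<in> {1..m}" "inv' \<tau> i \<in> {1..m}"
      using True permutes_in_image[OF permutes_inv] \<sigma> \<tau> by metis+
    ultimately show ?thesis using inv_b by metis
  next
    case False
    then show ?thesis using permutes_not_in[OF permutes_inv] \<sigma> \<tau> by metis
  qed
  then have "inv' \<sigma> = inv' \<tau>" by (rule ext)
  then show ?thesis using permutes_inv_inv[OF \<sigma>] permutes_inv_inv[OF \<tau>] by metis
qed

lemma ex_perm_on_B:
  assumes "bij_betw \<rho> B B"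
  shows "\<exists>\<sigma>. \<sigma> permutes {1..m} \<and> (\<forall>c\<in>B. perm_on_B \<sigma> c = \<rho> c)"
proof -
  define \<tau> where "\<tau> i = (if i \<in> {1..m} then inv_into {1..m} b (\<rho> (b i)) else i)" for i
  have "bij_betw (inv_into {1..m} b \<circ> (\<rho> \<circ> b)) {1..m} {1..m}"
    using bij_betw_trans[OF bij_betw_trans[OF bij_b assms] bij_betw_inv_into[OF bij_b]] .
  then have "bij_betw \<tau> {1..m} {1..m}" by (rule bij_betw_cong[THEN iffD1, rotated]) (simp add: \<tau>_def)
  then have \<tau>: "\<tau> permutes {1..m}" by (rule bij_imp_permutes) (auto simp: \<tau>_def)
  have "perm_on_B (inv' \<tau>) c = \<rho> c" if c: "c \<in> B" for c
  proof -
    have "\<rho> c \<in> B" using assms c by (rule bij_betw_apply)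
    then show ?thesis
      using b_inv[OF c] b_inv(2)[of "\<rho> c"] by (simp add: perm_on_B_def permutes_inv_inv[OF \<tau>] \<tau>_def)
  qed
  then show ?thesis using permutes_inv[OF \<tau>] by blast
qed

lemma triple:
  assumes w: "w \<in> projections" and s: "s \<in> sections" and \<sigma>: "\<sigma> permutes {1..m}"
  shows "triple w s \<sigma> \<in> carrier P" and "triple w s \<sigma> ` X = s ` B"
    and "map_ker X (triple w s \<sigma>) = map_ker X w"
    and "\<And>x. x \<in> X \<Longrightarrow> a (triple w s \<sigma> x) = perm_on_B \<sigma> (w x)"
    and "triple w s \<sigma> \<in> hat X a green_H `` {f}"
proof -
  have imw: "w ` Y = B" if "Y \<subseteq> X" "B \<subseteq> Y" for Y
  proof (intro subset_antisym image_subsetI subsetI)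
    show "w y \<in> B" if "y \<in> Y" for y using projection(1)[OF w] that \<open>Y \<subseteq> X\<close> by blast
    show "c \<in> w ` Y" if "c \<in> B" for c
      using projection(2)[OF w that] \<open>B \<subseteq> Y\<close> that by (metis image_eqI subsetD)
  qed
  have im: "triple w s \<sigma> ` Y = s ` B" if "Y \<subseteq> X" "B \<subseteq> Y" for Y
  proof -
    have "triple w s \<sigma> ` Y = s ` perm_on_B \<sigma> ` w ` Y"
      unfolding triple_def using that(1) by (simp add: image_image subset_iff cong: image_cong)
    then show ?thesis by (simp add: imw[OF that] perm_on_B(3)[OF \<sigma>])
  qed
  show imX: "triple w s \<sigma> ` X = s ` B" using im B_sub_X by simp
  show a: "a (triple w s \<sigma> x) = perm_on_B \<sigma> (w x)" if "x \<in> X" for x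
    using that section_apply(2)[OF s perm_on_B(1)[OF \<sigma> projection(1)[OF w that]]] by (simp add: triple_def)
  have inj_s: "inj_on s B" using section_apply(2)[OF s] by (metis inj_onI)
  show ker: "map_ker X (triple w s \<sigma>) = map_ker X w"
    unfolding map_ker_eq_iff triple_def
    using inj_on_eq_iff[OF inj_s] inj_on_eq_iff[OF perm_on_B(2)[OF \<sigma>]] perm_on_B(1)[OF \<sigma>] projection(1)[OF w]
    by simp
  show P: "triple w s \<sigma> \<in> carrier P"
  proof (rule P_I)
    show "triple w s \<sigma> \<in> extensional X" by (simp add: triple_def)
    show "triple w s \<sigma> ` X \<subseteq> X" unfolding imX using section_apply(1)[OF s] by auto
    show "triple w s \<sigma> ` A = triple w s \<sigma> ` X" using im A_sub B_sub B_sub_X by simp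
    show "inj_on a (triple w s \<sigma> ` X)" unfolding imX using section_apply(2)[OF s] by (auto intro!: inj_onI)
  qed
  have "a ` s ` B = B" using section_apply(2)[OF s] by (simp add: image_image cong: image_cong)
  moreover have "map_ker A (triple w s \<sigma>) = map_ker A f"
    using map_ker_A_eqI[OF ker] projection(3)[OF w] unfolding map_ker_eq_iff by simp
  ultimately show "triple w s \<sigma> \<in> hat X a green_H `` {f}"
    using f P imX by (simp add: hat_H hat_R hat_L B_def)
qed

text \<open>In the middle of the product stands \<open>w' \<circ> a \<circ> s\<close>, which is the identity on \<open>B\<close>. So the coordinates
multiply as in the direct product of a rectangular band and a group.\<close>
lemma triple_mult:
  assumes "w \<in> projections" "s \<in> sections" "\<sigma> permutes {1..m}"
    and "w' \<in> projections" "s' \<in> sections" "\<tau> permutes {1..m}"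
  shows "triple w s \<sigma> \<otimes>\<^bsub>P\<^esub> triple w' s' \<tau> = triple w s' (\<sigma> \<circ> \<tau>)"
proof (rule P_ext)
  have \<sigma>\<tau>: "(\<sigma> \<circ> \<tau>) permutes {1..m}" using assms(3,6) permutes_compose by blast
  show "triple w s \<sigma> \<otimes>\<^bsub>P\<^esub> triple w' s' \<tau> \<in> carrier P" using triple(1) assms by (intro mult_P_closed)
  show "triple w s' (\<sigma> \<circ> \<tau>) \<in> carrier P" using triple(1) assms \<sigma>\<tau> by blast
  fix x assume x: "x \<in> X"
  have c: "perm_on_B \<sigma> (w x) \<in> B" using perm_on_B(1) projection(1) assms x by blast
  show "(triple w s \<sigma> \<otimes>\<^bsub>P\<^esub> triple w' s' \<tau>) x = triple w s' (\<sigma> \<circ> \<tau>) x"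
    using x c B_sub_X projection(2)[OF assms(4) c]
    by (auto simp: mult_P_apply triple(4)[OF assms(1-3)] triple_def[of w'] triple_def[of w s']
        perm_on_B_comp[OF assms(3,6) projection(1)[OF assms(1) x]])
qed

lemma triple_inject:
  assumes 1: "w \<in> projections" "s \<in> sections" "\<sigma> permutes {1..m}"
    and 2: "w' \<in> projections" "s' \<in> sections" "\<tau> permutes {1..m}"
    and eq: "triple w s \<sigma> = triple w' s' \<tau>"
  shows "w = w' \<and> s = s' \<and> \<sigma> = \<tau>"
proof -
  have *: "perm_on_B \<sigma> (w x) = perm_on_B \<tau> (w' x)" if "x \<in> X" for x
    using triple(4)[OF 1 that] triple(4)[OF 2 that] eq by simp
  have "perm_on_B \<sigma> c = perm_on_B \<tau> c" if "c \<in> B" for c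
    using *[of c] projection(2) 1 2 B_sub_X that by (metis subsetD)
  then have \<sigma>\<tau>: "\<sigma> = \<tau>" using perm_on_B_inject 1 2 by blast
  have "w x = w' x" if "x \<in> X" for x
    using *[OF that] inj_onD[OF perm_on_B(2)[OF 2(3)]] projection(1) 1 2 that \<sigma>\<tau> by metis
  then have "w = w'" using 1(1) 2(1) unfolding projections_iff by (blast intro: PiE_ext)
  moreover have "s = s'"
  proof (rule PiE_ext[OF 1(2)[unfolded sections_def] 2(2)[unfolded sections_def]])
    fix c assume "c \<in> B"
    then obtain d where d: "d \<in> B" "c = perm_on_B \<sigma> d" using perm_on_B(3)[OF 1(3)] by blast
    then have "triple w s \<sigma> d = s c" "triple w' s' \<tau> d = s' c"
      using projection(2)[OF 1(1) d(1)] projection(2)[OF 2(1) d(1)] B_sub_X \<sigma>\<tau> by (auto simp: triple_def)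
    then show "s c = s' c" using eq by simp
  qed
  ultimately show ?thesis using \<sigma>\<tau> by simp
qed

text \<open>For \<open>g\<close> in the hat H-class of \<open>f\<close>, the map \<open>a \<circ> g\<close> permutes \<open>B\<close>. This permutation is the middle
coordinate of \<open>g\<close>.\<close>
lemma ex_triple:
  assumes "g \<in> hat X a green_H `` {f}"
  shows "\<exists>w\<in>projections. \<exists>s\<in>sections. \<exists>\<sigma>. \<sigma> permutes {1..m} \<and> g = triple w s \<sigma>"
proof -
  have g: "g \<in> carrier P" and ker: "map_ker A g = map_ker A f" and im: "a ` g ` X = B"
    using assms by (simp_all add: hat_H hat_R hat_L B_def)
  have ag: "a (g x) \<in> B" if "x \<in> X" for x using im that by blast
  have "g x = g y \<longleftrightarrow> f x = f y" if "x \<in> B" "y \<in> B" for x y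
    using that B_sub by (intro map_ker_eqD[OF ker]) (auto dest: subsetD)
  then have "inj_on g B" using inj_onD[OF inj[folded B_def]] by (intro inj_onI) simp
  then have inj_ag: "inj_on (a \<circ> g) B"
    using inj_on_subset[OF P_D(3)[OF g] image_mono[OF B_sub_X]] by (rule comp_inj_on)
  then have im_ag: "(a \<circ> g) ` B = B"
    using ag B_sub_X finite_B by (intro endo_inj_surj) auto
  then obtain \<sigma> where \<sigma>: "\<sigma> permutes {1..m}" "\<And>c. c \<in> B \<Longrightarrow> perm_on_B \<sigma> c = a (g c)"
    using ex_perm_on_B[of "a \<circ> g"] inj_ag unfolding bij_betw_def by auto
  define w where "w = (\<lambda>x\<in>X. inv_into B (a \<circ> g) (a (g x)))"
  define s where "s = (\<lambda>c\<in>B. inv_into (g ` X) a c)"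
  have w: "w x \<in> B" "a (g (w x)) = a (g x)" if "x \<in> X" for x
  proof -
    have im: "a (g x) \<in> (a \<circ> g) ` B" unfolding im_ag using ag[OF that] .
    show "w x \<in> B" "a (g (w x)) = a (g x)"
      using that inv_into_into[OF im] f_inv_into_f[OF im] by (simp_all add: w_def)
  qed
  have "w \<in> projections"
    unfolding projections_iff
  proof
    show "w \<in> X \<rightarrow>\<^sub>E B" using w(1) by (auto simp: w_def)
    show "\<forall>x\<in>A. w x = inv_into B (a \<circ> f) (a (f x))"
    proof
      fix x assume x: "x \<in> A"
      let ?c = "inv_into B (a \<circ> f) (a (f x))"
      have X: "x \<in> X" using x A_sub by blast
      have c: "?c \<in> B" "?c \<in> A" "?c \<in> X" using retract(1)[OF X] B_sub B_sub_X by auto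
      have "f ?c = f x" using retract(2)[OF X] af_eq_iff[OF c(3) X] by simp
      then have "g ?c = g x" using map_ker_eqD[OF ker c(2) x] by simp
      then have "(a \<circ> g) (w x) = (a \<circ> g) ?c" using w(2)[OF X] by simp
      then show "w x = ?c" using inj_onD[OF inj_ag] w(1)[OF X] c(1) by blast
    qed
  qed
  moreover have "s \<in> sections"
  proof -
    have "s c \<in> g ` X" "a (s c) = c" if "c \<in> B" for c
      using that im unfolding s_def by (simp_all add: inv_into_into f_inv_into_f)
    then show ?thesis unfolding sections_def using P_D(5)[OF g] by (auto simp: s_def)
  qed
  moreover have "g = triple w s \<sigma>"
  proof (rule extensionalityI[OF P_D(4)[OF g]])
    show "triple w s \<sigma> \<in> extensional X" by (simp add: triple_def)
    fix x assume x: "x \<in> X"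
    have "perm_on_B \<sigma> (w x) = a (g x)" using \<sigma>(2)[OF w(1)[OF x]] w(2)[OF x] by simp
    then show "g x = triple w s \<sigma> x"
      using x ag[OF x] inv_into_f_f[OF P_D(3)[OF g]] by (simp add: triple_def s_def)
  qed
  ultimately show ?thesis using \<sigma>(1) by blast
qed

lemma bij_triple:
  "bij_betw (\<lambda>((w, s), \<sigma>). triple w s \<sigma>) ((projections \<times> sections) \<times> carrier (sym_group m))
     (hat X a green_H `` {f})"
  unfolding bij_betw_def
proof
  show "inj_on (\<lambda>((w, s), \<sigma>). triple w s \<sigma>) ((projections \<times> sections) \<times> carrier (sym_group m))"
    using triple_inject by (auto simp: inj_on_def sym_group_carrier)
  show "(\<lambda>((w, s), \<sigma>). triple w s \<sigma>) ` ((projections \<times> sections) \<times> carrier (sym_group m))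
      = hat X a green_H `` {f}"
  proof (intro subset_antisym subsetI)
    fix g assume "g \<in> (\<lambda>((w, s), \<sigma>). triple w s \<sigma>) ` ((projections \<times> sections) \<times> carrier (sym_group m))"
    then show "g \<in> hat X a green_H `` {f}" using triple(5) by (auto simp: sym_group_carrier)
  next
    fix g assume "g \<in> hat X a green_H `` {f}"
    then obtain w s \<sigma> where "w \<in> projections" "s \<in> sections" "\<sigma> permutes {1..m}" "g = triple w s \<sigma>"
      using ex_triple by blast
    then show "g \<in> (\<lambda>((w, s), \<sigma>). triple w s \<sigma>) ` ((projections \<times> sections) \<times> carrier (sym_group m))"
      by (intro image_eqI[of _ _ "((w, s), \<sigma>)"]) (simp_all add: sym_group_carrier)
  qed
qed

lemma hat_H_sub: "hat X a green_H `` {f} \<subseteq> carrier P" by (auto simp: hat_def)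

text \<open>The H-class of \<open>g\<close> consists of the triples with the same outer coordinates as \<open>g\<close>. One inclusion
is clear, and both sets have \<open>m!\<close> elements.\<close>
lemma H_class_symmetric_group:
  assumes g: "g \<in> hat X a green_H `` {f}"
  shows "group (restrict_to P (green_H P `` {g}))" and "restrict_to P (green_H P `` {g}) \<cong> sym_group m"
proof -
  obtain w s \<sigma> where t: "w \<in> projections" "s \<in> sections" "\<sigma> permutes {1..m}" "g = triple w s \<sigma>"
    using ex_triple[OF g] by blast
  have gP: "g \<in> carrier P" using g hat_H_sub by blast
  have H: "green_H P `` {g} = {h \<in> carrier P. map_ker X h = map_ker X g \<and> h ` X = g ` X}"
    using gP by (auto simp: green_H_P)
  let ?S = "carrier (sym_group m)"
  have inj: "inj_on (triple w s) ?S"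
    using triple_inject t by (auto simp: inj_on_def sym_group_carrier)
  have sub: "triple w s ` ?S \<subseteq> green_H P `` {g}"
    unfolding H using triple(1-3)[OF t(1,2)] t(3,4) by (simp add: image_subset_iff sym_group_carrier)
  have "map_rank X g = m"
    using g m_eq rank_hat_R[of f g] by (simp add: hat_H)
  then have "card (green_H P `` {g}) = fact m" using card_ker_im_class[OF gP] by (simp add: H)
  moreover have "card (triple w s ` ?S) = fact m"
    using card_image[OF inj] by (simp add: sym_group_def card_permutations)
  moreover have "finite (green_H P `` {g})" by (rule finite_subset[OF _ finite_P]) (auto simp: H)
  ultimately have bij: "bij_betw (triple w s) ?S (green_H P `` {g})"
    using inj sub by (simp add: bij_betw_def card_subset_eq)
  have hom: "triple w s (\<sigma> \<otimes>\<^bsub>sym_group m\<^esub> \<tau>) = triple w s \<sigma> \<otimes>\<^bsub>P\<^esub> triple w s \<tau>"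
    if "\<sigma> \<in> ?S" "\<tau> \<in> ?S" for \<sigma> \<tau>
    using that t(1,2) by (simp add: triple_mult sym_group_carrier sym_group_mult)
  show "group (restrict_to P (green_H P `` {g}))"
    unfolding restrict_to_def
  proof (rule group_semigroup_of_transport[OF sym_group_is_group bij])
    fix \<sigma> \<tau> assume "\<sigma> \<in> ?S" "\<tau> \<in> ?S"
    then show "triple w s (\<sigma> \<otimes>\<^bsub>sym_group m\<^esub> \<tau>) = triple w s \<sigma> \<otimes>\<^bsub>P\<^esub> triple w s \<tau>" by (rule hom)
  qed
  show "restrict_to P (green_H P `` {g}) \<cong> sym_group m"
    unfolding restrict_to_def
  proof (rule semigroup_of_transport[OF bij])
    fix \<sigma> \<tau> assume st: "\<sigma> \<in> ?S" "\<tau> \<in> ?S"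
    then show "triple w s (\<sigma> \<otimes>\<^bsub>sym_group m\<^esub> \<tau>) = triple w s \<sigma> \<otimes>\<^bsub>P\<^esub> triple w s \<tau>" by (rule hom)
    show "\<sigma> \<otimes>\<^bsub>sym_group m\<^esub> \<tau> \<in> ?S"
      using st by (simp add: sym_group_carrier sym_group_mult permutes_compose)
  qed
qed

lemma rectangular_group_hat_H:
  assumes K: "bij_betw kw K projections" and L: "bij_betw ks L sections"
  shows "rectangular_group (restrict_to P (hat X a green_H `` {f})) K L (sym_group m)"
proof -
  let ?H = "hat X a green_H `` {f}" and ?S = "carrier (sym_group m)"
  let ?G = "rectangular_band K L \<times>\<times> sym_group m"
  define h where "h = (\<lambda>((i, j), \<sigma>). triple (kw i) (ks j) \<sigma>)"
  have car: "carrier ?G = (K \<times> L) \<times> ?S" by (simp add: DirProd_def rectangular_band_def)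
  have "bij_betw ((\<lambda>((w, s), \<sigma>). triple w s \<sigma>) \<circ> map_prod (map_prod kw ks) (\<lambda>\<sigma>. \<sigma>)) ((K \<times> L) \<times> ?S) ?H"
    by (intro bij_betw_trans[OF _ bij_triple] bij_betw_map_prod K L) (simp add: bij_betw_def)
  moreover have "(\<lambda>((w, s), \<sigma>). triple w s \<sigma>) \<circ> map_prod (map_prod kw ks) (\<lambda>\<sigma>. \<sigma>) = h"
    by (auto simp: h_def)
  ultimately have bij: "bij_betw h (carrier ?G) ?H" by (simp only: car)
  have mem: "kw i \<in> projections" "ks j \<in> sections" if "i \<in> K" "j \<in> L" for i j
    using that bij_betw_apply K L by metis+
  have mult: "((i, j), \<sigma>) \<otimes>\<^bsub>?G\<^esub> ((i', j'), \<tau>) = ((i, j'), \<sigma> \<circ> \<tau>)" for i j \<sigma> i' j' \<tau>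
    by (simp add: DirProd_def rectangular_band_def sym_group_mult)
  have hom: "h (x \<otimes>\<^bsub>?G\<^esub> y) = h x \<otimes>\<^bsub>P\<^esub> h y" if "x \<in> carrier ?G" "y \<in> carrier ?G" for x y
    using that unfolding car h_def
    by (elim SigmaE) (simp only: mult prod.case triple_mult mem sym_group_carrier)
  have cl: "x \<otimes>\<^bsub>?G\<^esub> y \<in> carrier ?G" if "x \<in> carrier ?G" "y \<in> carrier ?G" for x y
    using that unfolding car
    by (elim SigmaE) (simp only: mult mem_Sigma_iff sym_group_carrier permutes_compose simp_thms)
  have "semigroup_of ?H (mult P) \<cong> ?G"
  proof (rule semigroup_of_transport[OF bij])
    fix x y assume xy: "x \<in> carrier ?G" "y \<in> carrier ?G"
    show "h (x \<otimes>\<^bsub>?G\<^esub> y) = h x \<otimes>\<^bsub>P\<^esub> h y" using xy by (rule hom)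
    show "x \<otimes>\<^bsub>?G\<^esub> y \<in> carrier ?G" using xy by (rule cl)
  qed
  then have "restrict_to P ?H \<cong> ?G" by (simp only: restrict_to_def)
  moreover have "is_semigroup (restrict_to P ?H)"
  proof -
    have "u \<otimes>\<^bsub>P\<^esub> v \<in> ?H" if "u \<in> ?H" "v \<in> ?H" for u v
    proof -
      have "u \<in> h ` carrier ?G" "v \<in> h ` carrier ?G"
        using that by (simp_all only: bij_betw_imp_surj_on[OF bij])
      then obtain x y where xy: "x \<in> carrier ?G" "u = h x" "y \<in> carrier ?G" "v = h y" by blast
      then show ?thesis using hom[of x y] bij_betw_apply[OF bij cl[of x y]] by simp
    qed
    moreover have "u \<otimes>\<^bsub>P\<^esub> v \<otimes>\<^bsub>P\<^esub> z = u \<otimes>\<^bsub>P\<^esub> (v \<otimes>\<^bsub>P\<^esub> z)"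
      if "u \<in> ?H" "v \<in> ?H" "z \<in> ?H" for u v z
      using is_semigroup_P that hat_H_sub unfolding is_semigroup_def by blast
    ultimately show ?thesis by (simp add: is_semigroup_def restrict_to_def)
  qed
  ultimately show ?thesis by (simp add: rectangular_group_def sym_group_is_group)
qed

end

context idempotent_map
begin

lemma ex_group_hat_class:
  assumes "f \<in> carrier P" and "inj_on f (a ` f ` X)"
  obtains b where "group_hat_class X a f (map_rank X f) b"
proof -
  have "finite (a ` f ` X)" using fin by simp
  from ex_bij_betw_nat_finite_1[OF this]
  obtain b where "bij_betw b {1..card (a ` f ` X)} (a ` f ` X)" by (rule exE)
  then have "group_hat_class X a f (map_rank X f) b"
    using assms card_image_a[OF assms(1)] by unfold_locales simp_all
  then show thesis by (rule that)
qed

lemma H_class_group_iff: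
  assumes f: "f \<in> carrier P"
  shows "group (restrict_to P (green_H P `` {f})) \<longleftrightarrow> inj_on f (a ` f ` X)"
proof
  assume "inj_on f (a ` f ` X)"
  then obtain b where "group_hat_class X a f (map_rank X f) b" by (rule ex_group_hat_class[OF f])
  moreover have "f \<in> hat X a green_H `` {f}" using f by (simp add: hat_H hat_R hat_L)
  ultimately show "group (restrict_to P (green_H P `` {f}))" by (rule group_hat_class.H_class_symmetric_group)
qed (rule inj_on_if_H_class_group[OF f])

text \<open>The criterion for \<open>f\<close> and the one for \<open>phi X a f\<close>, in the full transformation semigroup of \<open>A\<close>, are
the same condition.\<close>
lemma phi_H_class_group_iff:
  assumes f: "f \<in> carrier P"
  shows "group (restrict_to (full_trans A) (green_H (full_trans A) `` {phi X a f}))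
         \<longleftrightarrow> inj_on f (a ` f ` X)"
proof -
  have "group (restrict_to (full_trans A) (green_H (full_trans A) `` {phi X a f}))
         \<longleftrightarrow> inj_on (phi X a f) ((\<lambda>x. x) ` phi X a f ` A)"
    unfolding full_trans_A
    by (rule idempotent_map.H_class_group_iff[OF idempotent_map_A])
       (use phi_closed[OF f] in \<open>simp add: full_trans_A\<close>)
  also have "(\<lambda>x. x) ` phi X a f ` A = a ` f ` X" by (simp add: image_phi[OF f])
  also have "inj_on (phi X a f) (a ` f ` X) \<longleftrightarrow> inj_on f (a ` f ` X)"
  proof -
    have "a ` f ` X \<subseteq> A" using P_D(5)[OF f] by (rule image_mono)
    then have "phi X a f x = phi X a f y \<longleftrightarrow> f x = f y" if "x \<in> a ` f ` X" "y \<in> a ` f ` X" for x y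
      using that by (intro map_ker_eqD[OF map_ker_phi[OF f]]) (auto dest: subsetD)
    then show ?thesis unfolding inj_on_def by simp
  qed
  finally show ?thesis .
qed

lemma inj_on_hat_H:
  assumes "(f, g) \<in> hat X a green_H"
  shows "inj_on g (a ` g ` X) \<longleftrightarrow> inj_on f (a ` f ` X)"
proof -
  have f: "f \<in> carrier P" and ker: "map_ker A f = map_ker A g" and im: "a ` f ` X = a ` g ` X"
    using assms by (simp_all add: hat_H hat_R hat_L)
  have "a ` f ` X \<subseteq> A" using P_D(5)[OF f] by (rule image_mono)
  then have "f x = f y \<longleftrightarrow> g x = g y" if "x \<in> a ` f ` X" "y \<in> a ` f ` X" for x y
    using that by (intro map_ker_eqD[OF ker]) (auto dest: subsetD)
  then show ?thesis unfolding im[symmetric] inj_on_def by simp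
qed

lemma H_class_cases:
  assumes "K \<in> carrier P // green_H P" and "K \<subseteq> hat X a green_H `` {f}"
  obtains g where "g \<in> carrier P" "(f, g) \<in> hat X a green_H" "K = green_H P `` {g}"
proof -
  obtain g where g: "g \<in> carrier P" "K = green_H P `` {g}" using assms(1) by (rule quotientE)
  then have "g \<in> K" by (simp add: green_H_P)
  then show thesis using that g assms(2) by blast
qed

end

section \<open>The size and structure of the classes\<close>

text \<open>The indices of the kernel classes of \<open>a\<close> are traded for the points of \<open>A\<close>: the class \<open>Acl j\<close> is the
fibre of \<open>a\<close> over \<open>q j\<close>.\<close>
lemma kernel_classes_indexing:
  assumes "bij_betw Acl {1..r} (X // map_ker X a)"
  obtains q where "bij_betw q {1..r} (a ` X)" and "\<And>j. j \<in> {1..r} \<Longrightarrow> Acl j = {x \<in> X. a x = q j}"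
proof -
  let ?fib = "\<lambda>c. {x \<in> X. a x = c}"
  have "inj_on ?fib (a ` X)"
  proof (rule inj_onI)
    fix c d assume "c \<in> a ` X" "?fib c = ?fib d"
    then show "c = d" by blast
  qed
  moreover have "?fib ` a ` X = X // map_ker X a"
  proof -
    have "?fib (a x) = map_ker X a `` {x}" if "x \<in> X" for x using that by (auto simp: map_ker_def)
    then show ?thesis by (auto simp: quotient_def)
  qed
  ultimately have fib: "bij_betw ?fib (a ` X) (X // map_ker X a)" by (simp add: bij_betw_def)
  let ?q = "inv_into (a ` X) ?fib \<circ> Acl"
  have "bij_betw ?q {1..r} (a ` X)" by (rule bij_betw_trans[OF assms bij_betw_inv_into[OF fib]])
  moreover have "Acl j = ?fib (?q j)" if "j \<in> {1..r}" for j
    using bij_betw_inv_into_right[OF fib bij_betw_apply[OF assms that]] by simp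
  ultimately show thesis by (rule that)
qed

theorem theorem5p7:
  fixes X :: "'a set" and a f :: "'a \<Rightarrow> 'a" and n r m :: nat
    and Acl :: "nat \<Rightarrow> 'a set" and lam :: "nat \<Rightarrow> nat" and Lam :: "nat set \<Rightarrow> nat"
    and P :: "('a \<Rightarrow> 'a) monoid" and fi :: "nat \<Rightarrow> 'a" and k :: "nat \<Rightarrow> nat" and I :: "nat set"
  assumes "finite X" and "card X = n"
    and "a \<in> carrier (full_trans X)" and "a \<otimes>\<^bsub>full_trans X\<^esub> a = a"
    and "r = map_rank X a" and "1 < r" and "r < n"
    and "bij_betw Acl {1..r} (X // map_ker X a)"
    and "\<And>i. lam i = card (Acl i)"
    and "\<And>J. Lam J = (\<Prod>j\<in>J. lam j)"
    and "P = reg_variant X a"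
    and "f \<in> carrier P" and "map_rank X f = m"
    and "f ` X = fi ` {1..m}"
    and "\<And>i. i \<in> {1..m} \<Longrightarrow> k i \<in> {1..r} \<and> fi i \<in> Acl (k i)"
    and "I = k ` {1..m}"
  shows "
    \<comment> \<open>(i)\<close>
    is_union_of (hat X a green_R `` {f}) (m ^ (n - r)) (carrier P // green_R P) \<and>
    \<comment> \<open>(ii)\<close>
    is_union_of (hat X a green_L `` {f}) (Lam I) (carrier P // green_L P) \<and>
    \<comment> \<open>(iii)\<close>
    is_union_of (hat X a green_H `` {f}) (m ^ (n - r) * Lam I) (carrier P // green_H P) \<and>
    (\<forall>K \<in> carrier P // green_H P. K \<subseteq> hat X a green_H `` {f} \<longrightarrow> card K = fact m) \<and>
    (\<forall>K \<in> carrier P // green_H P. inj_on (phi X a) K) \<and>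
    \<comment> \<open>(iv)\<close>
    (\<not> group (restrict_to (full_trans (a ` X)) (green_H (full_trans (a ` X)) `` {phi X a f})) \<longrightarrow>
      (\<forall>K \<in> carrier P // green_H P. K \<subseteq> hat X a green_H `` {f} \<longrightarrow>
         \<not> group (restrict_to P K))) \<and>
    \<comment> \<open>(v)\<close>
    (group (restrict_to (full_trans (a ` X)) (green_H (full_trans (a ` X)) `` {phi X a f})) \<longrightarrow>
      (\<forall>K \<in> carrier P // green_H P. K \<subseteq> hat X a green_H `` {f} \<longrightarrow>
         group (restrict_to P K) \<and> restrict_to P K \<cong> sym_group m) \<and>
      (\<exists>(K :: nat set) (L :: nat set).
         finite K \<and> card K = m ^ (n - r) \<and> finite L \<and> card L = Lam I \<and>
         rectangular_group (restrict_to P (hat X a green_H `` {f})) K L (sym_group m))) \<and>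
    \<comment> \<open>(vi)\<close>
    hat X a green_D = green_D P \<and>
    hat X a green_D `` {f} = green_D P `` {f} \<and>
    green_D P `` {f} = {g \<in> carrier P. map_rank X g = m} \<and>
    is_union_of (hat X a green_D `` {f}) (m ^ (n - r) * Stirling r m) (carrier P // green_R P) \<and>
    is_union_of (hat X a green_D `` {f}) (\<Sum>J | J \<subseteq> {1..r} \<and> card J = m. Lam J)
      (carrier P // green_L P) \<and>
    is_union_of (hat X a green_D `` {f})
      (m ^ (n - r) * Stirling r m * (\<Sum>J | J \<subseteq> {1..r} \<and> card J = m. Lam J))
      (carrier P // green_H P)"
proof -
  have a_PiE: "a \<in> X \<rightarrow>\<^sub>E X" using assms(3) by (simp add: full_trans_def)
  have idem: "a (a x) = a x" if "x \<in> X" for x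
    using fun_cong[OF assms(4), of x] that by (simp add: full_trans_def compose_def)
  interpret idempotent_map X a
    by unfold_locales (use assms(1) a_PiE idem in auto)
  let ?A = "a ` X" and ?fib = "\<lambda>c. card {x \<in> X. a x = c}"
  have P: "P = reg_variant X a" by (rule assms(11))
  have f: "f \<in> carrier (reg_variant X a)" using assms(12) P by simp
  have rank: "map_rank X f = m" by (rule assms(13))
  have card_A: "card ?A = r" using assms(5) by (simp add: map_rank_def)
  have card_diff: "card (X - ?A) = n - r"
    using card_Diff_subset[OF finite_imageI[OF fin] A_sub] assms(2) card_A by simp
  obtain q where q: "bij_betw q {1..r} ?A" and Acl: "\<And>j. j \<in> {1..r} \<Longrightarrow> Acl j = {x \<in> X. a x = q j}"
    using kernel_classes_indexing[OF assms(8)] by metis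
  have inj_q: "inj_on q {1..r}" using q by (rule bij_betw_imp_inj_on)
  have Lam: "Lam J = (\<Prod>c\<in>q ` J. ?fib c)" if "J \<subseteq> {1..r}" for J
  proof -
    have "Lam J = (\<Prod>j\<in>J. ?fib (q j))"
      unfolding assms(10) using that assms(9) Acl by (intro prod.cong refl) auto
    also have "\<dots> = (\<Prod>c\<in>q ` J. ?fib c)"
      using prod.reindex[OF inj_on_subset[OF inj_q that], of ?fib] by (simp only: o_def)
    finally show ?thesis .
  qed
  have q_I: "q ` I = a ` f ` X"
  proof -
    have "a (fi i) = q (k i)" if "i \<in> {1..m}" for i
      using assms(15)[OF that] Acl[of "k i"] by auto
    then have "q ` k ` {1..m} = a ` fi ` {1..m}" unfolding image_image by (intro image_cong refl) simp
    then show ?thesis by (simp only: assms(14,16))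
  qed
  have I: "I \<subseteq> {1..r}" using assms(15,16) by blast
  have Lam_I: "(\<Prod>c\<in>a ` f ` X. ?fib c) = Lam I" using Lam[OF I] q_I by simp
  have Lam_sum: "(\<Sum>B | B \<subseteq> ?A \<and> card B = m. \<Prod>c\<in>B. ?fib c) = (\<Sum>J | J \<subseteq> {1..r} \<and> card J = m. Lam J)"
  proof -
    have "bij_betw (image q) {J. J \<subseteq> {1..r} \<and> card J = m} {B. B \<subseteq> ?A \<and> card B = m}"
    proof (rule bij_betw_subset[OF bij_betw_Pow[OF q]])
      have card: "card (q ` J) = card J" if "J \<subseteq> {1..r}" for J
        using that inj_q by (meson card_image inj_on_subset)
      show "image q ` {J. J \<subseteq> {1..r} \<and> card J = m} = {B. B \<subseteq> ?A \<and> card B = m}"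
      proof (intro subset_antisym subsetI)
        fix B assume "B \<in> {B. B \<subseteq> ?A \<and> card B = m}"
        moreover from this obtain J where "J \<subseteq> {1..r}" "B = q ` J"
          using bij_betw_imp_surj_on[OF q] by (metis mem_Collect_eq subset_imageE)
        ultimately show "B \<in> image q ` {J. J \<subseteq> {1..r} \<and> card J = m}" using card by auto
      next
        fix B assume "B \<in> image q ` {J. J \<subseteq> {1..r} \<and> card J = m}"
        then obtain J where "J \<subseteq> {1..r}" "card J = m" "B = q ` J" by blast
        then show "B \<in> {B. B \<subseteq> ?A \<and> card B = m}"
          using card by (simp add: bij_betw_imp_surj_on[OF q, symmetric] image_mono)
      qed
    qed auto
    from sum.reindex_bij_betw[OF this, of "\<lambda>B. \<Prod>c\<in>B. ?fib c", symmetric]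
    show ?thesis by (rule trans) (intro sum.cong refl, simp add: Lam)
  qed
  have H_card: "card K = fact m" if K: "K \<in> carrier (reg_variant X a) // green_H (reg_variant X a)"
    "K \<subseteq> hat X a green_H `` {f}" for K
  proof -
    obtain g where g: "g \<in> carrier (reg_variant X a)" "(f, g) \<in> hat X a green_H" "K = green_H (reg_variant X a) `` {g}"
      using H_class_cases[OF K] by blast
    have "K = {h \<in> carrier (reg_variant X a). map_ker X h = map_ker X g \<and> h ` X = g ` X}"
      using g(1,3) by (auto simp: green_H_P)
    then show ?thesis using card_ker_im_class[OF g(1)] rank_hat_R[of f g] g(2) rank by (simp add: hat_H)
  qed
  have non_group: "\<not> group (restrict_to (reg_variant X a) K)"
    if "\<not> group (restrict_to (full_trans ?A) (green_H (full_trans ?A) `` {phi X a f}))"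
      and K: "K \<in> carrier (reg_variant X a) // green_H (reg_variant X a)" "K \<subseteq> hat X a green_H `` {f}" for K
  proof -
    obtain g where g: "g \<in> carrier (reg_variant X a)" "(f, g) \<in> hat X a green_H" "K = green_H (reg_variant X a) `` {g}"
      using H_class_cases[OF K] by blast
    then show ?thesis using that(1) phi_H_class_group_iff[OF f] H_class_group_iff[OF g(1)] inj_on_hat_H by simp
  qed
  have groups: "(\<forall>K \<in> carrier (reg_variant X a) // green_H (reg_variant X a). K \<subseteq> hat X a green_H `` {f} \<longrightarrow>
         group (restrict_to (reg_variant X a) K) \<and> restrict_to (reg_variant X a) K \<cong> sym_group m) \<and>
      (\<exists>(K :: nat set) (L :: nat set).
         finite K \<and> card K = m ^ (n - r) \<and> finite L \<and> card L = Lam I \<and>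
         rectangular_group (restrict_to (reg_variant X a) (hat X a green_H `` {f})) K L (sym_group m))"
    if "group (restrict_to (full_trans ?A) (green_H (full_trans ?A) `` {phi X a f}))"
  proof -
    have "inj_on f (a ` f ` X)" using that phi_H_class_group_iff[OF f] by simp
    then obtain b where "group_hat_class X a f m b" using ex_group_hat_class[OF f] rank by metis
    then interpret G: group_hat_class X a f m b .
    have "finite G.projections" "finite G.sections"
      using fin G.finite_B unfolding G.projections_def G.sections_def
      by (auto intro!: finite_PiE intro: finite_subset[OF _ finite_PiE[of X "\<lambda>_. G.B"]])
    then obtain kw ks where kw: "bij_betw kw {0..<card G.projections} G.projections"
      and ks: "bij_betw ks {0..<card G.sections} G.sections"
      using ex_bij_betw_nat_finite by metis
    have "rectangular_group (restrict_to (reg_variant X a) (hat X a green_H `` {f}))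
        {0..<m ^ (n - r)} {0..<Lam I} (sym_group m)"
      using G.rectangular_group_hat_H[OF kw ks] G.card_projections G.card_sections card_diff Lam_I G.B_def
      by simp
    moreover have "group (restrict_to (reg_variant X a) K) \<and> restrict_to (reg_variant X a) K \<cong> sym_group m"
      if K: "K \<in> carrier (reg_variant X a) // green_H (reg_variant X a)" "K \<subseteq> hat X a green_H `` {f}" for K
    proof -
      obtain g where g: "(f, g) \<in> hat X a green_H" "K = green_H (reg_variant X a) `` {g}"
        using H_class_cases[OF K] by blast
      then show ?thesis using G.H_class_symmetric_group[of g] by simp
    qed
    ultimately show ?thesis by (metis card_atLeastLessThan diff_zero finite_atLeastLessThan)
  qed
  have D: "hat X a green_D `` {f} = green_D (reg_variant X a) `` {f}" by (simp add: hat_D)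
  note classes = hat_R_classes[OF f] hat_L_classes[OF f] hat_H_classes[OF f]
    D_R_classes[OF f] D_L_classes[OF f] D_H_classes[OF f]
  show ?thesis
    unfolding P D
    using classes[unfolded rank card_diff card_A Lam_I Lam_sum] green_D_class[OF f, unfolded rank]
    by (intro conjI impI ballI refl hat_D inj_on_phi_H_class H_card non_group groups[THEN conjunct2])
      (use groups in blast)+
qed

end
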